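(* Let $n\ge 1$, $t>0$ and $\mathbf{C}_n(t)=\{(x_1,\dots,x_n):1\le x_1\le 1+t,\ 1\le x_i\le(1+t)x_{i-1}\ (2\le i\le n)\}$. For a labeled tree $T$ on $\{1,\dots,n+1\}$, let the node with label $k$ have NFS position $i_k$ and $j_k$ cane paths starting at it, and let $$\mathbf{S}_T(t)=\{(x_1,\dots,x_n):1\le x_{i_1}/(1+t)^{j_1}\le x_{i_2}/(1+t)^{j_2}\le\dots\le x_{i_n}/(1+t)^{j_n}\le 1+t\}.$$ Then $\mathbf{S}_T(t)$ is a simplex and $$n!\operatorname{vol}\mathbf{S}_T(t)=\sum_{G\text{ connected},\ \Phi(G)=T} t^{|E(G)|}=t^n(1+t)^{\alpha(T)},$$ the sum over connected labeled graphs $G$ on $\{1,\dots,n+1\}$. Furthermore, the simplices $\mathbf{S}_T(t)$, $T$ ranging over labeled trees on $\{1,\dots,n+1\}$, form a triangulation of $\mathbf{C}_n(t)$; in particular $n!\operatorname{vol}\mathbf{C}_n(t)=\sum_{G}t^{|E(G)|}$, the sum over all connected labeled graphs $G$ on $\{1,\dots,n+1\}$.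
   Context: Labeled forest conventions: each component of a labeled forest on $\{1,\dots,n+1\}$ is rooted at its node of largest label, children are ordered left to right by increasing label, components left to right by decreasing largest label. NFS positions in a forest on $n+1$ nodes: components processed left to right; when a component is begun its root gets the next unused position (starting from $0$, so node $n+1$ has position $0$); within a component the root is initially active, the children of the active node receive the next consecutive positions from right to left and then the leftmost child becomes active; if the active node has no children, the most recently positioned node not yet active becomes active. Cane path: a path $v_0,\dots,v_k$ ($k\ge 2$) whose first $k-1$ steps go from a node to its parent and whose last step goes from $v_{k-1}$ to a child of $v_{k-1}$ to the right of $v_{k-2}$. $\alpha(T)$ is the total number of cane paths in $T$. NFS of a labeled graph $G$ on $\{1,\dots,n+1\}$: components are processed in order of decreasing maximal label; in a component, its node of maximal label is visited first and made active; at each step the unvisited neighbours of the active node are visited in decreasing order of label, each joined to the active node by a search edge, and the one of smallest label becomes active; if the active node has no unvisited neighbours, the most recently visited node not yet active becomes active. $\Phi(G)$ is the labeled forest of search edges. $E(G)$ is the edge set of $G$. A triangulation of a polytope $P\subset\mathbb{R}^n$ is a set of $n$-simplices with union $P$ and pairwise disjoint interiors. *)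

theory Defs
  imports "HOL-Analysis.Analysis"
begin

section \<open>Labeled graphs, trees and rooted forests\<close>

text \<open>
  A simple graph on the labels \<open>{1..n+1}\<close> is given by its set of edges, which are two-element
  sets of labels, so \<open>|E(G)|\<close> is \<open>card G\<close>.
\<close>

definition labeled_graph :: "nat \<Rightarrow> nat set set \<Rightarrow> bool" where
  "labeled_graph n E \<longleftrightarrow> E \<subseteq> {e. e \<subseteq> {1..n+1} \<and> card e = 2}"

definition linked :: "nat set set \<Rightarrow> (nat \<times> nat) set" where
  "linked E = {(a, b). {a, b} \<in> E}\<^sup>*"

definition connected_graph :: "nat \<Rightarrow> nat set set \<Rightarrow> bool" where
  "connected_graph n E \<longleftrightarrow>
     labeled_graph n E \<and> (\<forall>u\<in>{1..n+1}. \<forall>v\<in>{1..n+1}. (u, v) \<in> linked E)"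

definition graph_path :: "nat set set \<Rightarrow> nat list \<Rightarrow> bool" where
  "graph_path E p \<longleftrightarrow> p \<noteq> [] \<and> distinct p \<and> successively (\<lambda>a b. {a, b} \<in> E) p"

definition has_cycle :: "nat set set \<Rightarrow> bool" where
  "has_cycle E \<longleftrightarrow> (\<exists>p. graph_path E p \<and> 3 \<le> length p \<and> {last p, hd p} \<in> E)"

definition labeled_tree :: "nat \<Rightarrow> nat set set \<Rightarrow> bool" where
  "labeled_tree n T \<longleftrightarrow> connected_graph n T \<and> \<not> has_cycle T"

text \<open>Each component of a labeled forest is rooted at its node of largest label.\<close>

definition root_of :: "nat \<Rightarrow> nat set set \<Rightarrow> nat \<Rightarrow> nat" where
  "root_of n F v = Max {w \<in> {1..n+1}. (v, w) \<in> linked F}"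

definition parent_of :: "nat \<Rightarrow> nat set set \<Rightarrow> nat \<Rightarrow> nat \<Rightarrow> bool" where
  "parent_of n F u v \<longleftrightarrow>
     (\<exists>p. graph_path F (v # u # p) \<and> last (v # u # p) = root_of n F v)"

definition children :: "nat \<Rightarrow> nat set set \<Rightarrow> nat \<Rightarrow> nat set" where
  "children n F u = {v \<in> {1..n+1}. parent_of n F u v}"

section \<open>Neighbors-first search\<close>

record nfs_state =
  visited :: "nat list"  \<comment> \<open>in the order in which the nodes were visited\<close>
  activated :: "nat set" \<comment> \<open>nodes that are or have been active\<close>
  active :: nat
  search_edges :: "nat set set"

text \<open>
  One step makes exactly one further node active. The parameter \<open>adj\<close> gives the candidates for
  the next nodes to be visited from the active node: its neighbors in a graph, or its children in
  a rooted forest. Siblings are ordered from left to right by increasing label, so the right to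
  left order is the order of decreasing label and the leftmost child has the smallest label. In
  the third case the current component is exhausted, and the largest unvisited label is the
  largest label of the next component.
\<close>

definition nfs_step :: "nat \<Rightarrow> (nat \<Rightarrow> nat set) \<Rightarrow> nfs_state \<Rightarrow> nfs_state" where
  "nfs_step n adj s =
    (let new = adj (active s) - set (visited s);
         waiting = filter (\<lambda>v. v \<notin> activated s) (visited s);
         rest = {1..n+1} - set (visited s)
     in if new \<noteq> {} then
          \<lparr> visited = visited s @ rev (sorted_list_of_set new),
            activated = insert (Min new) (activated s),
            active = Min new,
            search_edges = search_edges s \<union> {{active s, w} | w. w \<in> new} \<rparr>
        else if waiting \<noteq> [] then
          s \<lparr> activated := insert (last waiting) (activated s), active := last waiting \<rparr>
        else
          s \<lparr> visited := visited s @ [Max rest],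
              activated := insert (Max rest) (activated s), active := Max rest \<rparr>)"

definition nfs_init :: "nat \<Rightarrow> nfs_state" where
  "nfs_init n = \<lparr> visited = [n+1], activated = {n+1}, active = n+1, search_edges = {} \<rparr>"

text \<open>After \<open>n\<close> steps all \<open>n+1\<close> nodes have been activated, and the search is complete.\<close>

definition nfs :: "nat \<Rightarrow> (nat \<Rightarrow> nat set) \<Rightarrow> nfs_state" where
  "nfs n adj = (nfs_step n adj ^^ n) (nfs_init n)"

definition nfs_forest :: "nat \<Rightarrow> nat set set \<Rightarrow> nat set set" where
  "nfs_forest n G = search_edges (nfs n (\<lambda>v. {w. {v, w} \<in> G}))"

text \<open>The position of \<open>k\<close> is its index, counted from 0, in the list of nodes in search order.\<close>

definition nfs_position :: "nat \<Rightarrow> nat set set \<Rightarrow> nat \<Rightarrow> nat" where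
  "nfs_position n F k = length (takeWhile (\<lambda>v. v \<noteq> k) (visited (nfs n (children n F))))"

section \<open>Cane paths\<close>

text \<open>A path \<open>v\<^sub>0, \<dots>, v\<^sub>k\<close> is a list of length \<open>k + 1\<close>; right siblings have larger labels.\<close>

definition cane_path :: "nat \<Rightarrow> nat set set \<Rightarrow> nat list \<Rightarrow> bool" where
  "cane_path n F vs \<longleftrightarrow>
     (\<exists>k\<ge>2. length vs = k + 1 \<and> set vs \<subseteq> {1..n+1} \<and>
        (\<forall>i<k - 1. parent_of n F (vs ! (i + 1)) (vs ! i)) \<and>
        vs ! k \<in> children n F (vs ! (k - 1)) \<and> vs ! (k - 2) < vs ! k)"

definition canes_from :: "nat \<Rightarrow> nat set set \<Rightarrow> nat \<Rightarrow> nat" where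
  "canes_from n F v = card {vs. cane_path n F vs \<and> hd vs = v}"

definition cane_number :: "nat \<Rightarrow> nat set set \<Rightarrow> nat" where
  "cane_number n F = card {vs. cane_path n F vs}"

section \<open>Polytopes\<close>

text \<open>
  Points of \<open>\<real>\<^sup>n\<close> are vectors over a finite index type; a bijection \<open>e\<close> from \<open>{1..n}\<close> to the
  index type numbers the coordinates, so that \<open>x\<^sub>i\<close> is \<open>x $ e i\<close>.
\<close>

definition cayley_polytope :: "(nat \<Rightarrow> 'n::finite) \<Rightarrow> nat \<Rightarrow> real \<Rightarrow> (real ^ 'n) set" where
  "cayley_polytope e n t =
     {x. 1 \<le> x $ e 1 \<and> x $ e 1 \<le> 1 + t \<and>
         (\<forall>i\<in>{2..n}. 1 \<le> x $ e i \<and> x $ e i \<le> (1 + t) * x $ e (i - 1))}"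

definition tree_simplex ::
    "(nat \<Rightarrow> 'n::finite) \<Rightarrow> nat \<Rightarrow> real \<Rightarrow> nat set set \<Rightarrow> (real ^ 'n) set" where
  "tree_simplex e n t T =
     {x. let y = (\<lambda>k. x $ e (nfs_position n T k) / (1 + t) ^ canes_from n T k)
         in 1 \<le> y 1 \<and> (\<forall>k\<in>{1..<n}. y k \<le> y (k + 1)) \<and> y n \<le> 1 + t}"

text \<open>
  Unlike the library's notion \<open>triangulation\<close>, simplices are not required to meet in common faces.
\<close>

definition polytope_triangulation :: "'a::euclidean_space set set \<Rightarrow> 'a set \<Rightarrow> bool" where
  "polytope_triangulation \<S> P \<longleftrightarrow>
     polytope P \<and> (\<forall>S\<in>\<S>. int DIM('a) simplex S) \<and> \<Union>\<S> = P \<and>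
     pairwise (\<lambda>S S'. interior S \<inter> interior S' = {}) \<S>"

end

theory Submission
  imports Defs
begin

text \<open>
  Neighbors-first search is a search with a stack: the active node is popped and its new nodes are
  pushed in decreasing order of label. When a node \<open>v\<close> becomes active, the stack consists of the
  larger siblings of \<open>v\<close> and of its ancestors, which are the end points of the cane paths from \<open>v\<close>.
  Adding to the search tree \<open>T\<close> an edge from a node to a node of the stack at its activation does
  not change the search, and these are the only edges with this property, so
  \<open>\<Phi>(G) = T\<close> has \<open>2\<close> to the power \<open>\<alpha>(T)\<close> solutions with generating function
  \<open>t\<^sup>n (1 + t)\<^bsup>\<alpha>(T)\<^esup>\<close>.

  The number of cane paths from a node is the height at which it is pushed on the stack. In search
  order, this height either does not increase, or it increases by one and the label decreases, and
  every such sequence of labels and heights is obtained from exactly one tree. On the other side, a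
  point of the Cayley polytope is given by the exponents \<open>j\<close> with
  \<open>x\<^sub>i / (1 + t)\<^sup>j \<in> [1, 1 + t]\<close> and by the order of these quotients, and \<open>x\<^sub>i \<le> (1 + t) x\<^bsub>i-1\<^esub>\<close>
  is the same condition on exponents and order. Finally, a simplex of the triangulation is, up to
  rescaling and permuting coordinates, one of the \<open>n!\<close> congruent order simplices that tile a cube
  with side \<open>t\<close>.
\<close>

section \<open>Trees given by parent functions\<close>

text \<open>Three searches have to be compared: that of a graph along its edges, that of a tree
  along its children, and the decoding of labels with heights. They differ only in the rule for the
  new nodes, so all are described by the same four sequences \<open>C\<close>, \<open>V\<close>,
  \<open>a\<close>, \<open>S\<close>, and runs whose rules agree coincide. Equality of trees,
  \<Phi>(G) = T and the reconstruction of a tree thus become statements about the sets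
  \<open>C m\<close>. Parents, roots and cane paths are defined by paths in an edge set; they are
  turned into recursions along a parent function. Numbers of cane paths then obey the recursion of
  stack heights: each node adds its larger siblings to the number of its parent. The factor (1 + t)
  to the power \<alpha>(T) arises in two independent ways: from summing over the subsets of
  \<alpha>(T) optional edges, and as the product of the scale factors of the coordinates. No
  integral is computed: scaling and permuting coordinates is linear, and the unscaled simplex is
  measured by the cube that its copies fill.\<close>

lemma successively_nthD:
  assumes "successively P xs" "Suc i < length xs"
  shows "P (xs ! i) (xs ! Suc i)"
  using assms
proof (induction xs arbitrary: i rule: induct_list012)
  case (3 x y zs)
  then show ?case by (cases i) auto
qed auto

lemma linked_sym: "(u, v) \<in> linked E \<Longrightarrow> (v, u) \<in> linked E"
proof -
  have "sym {(a, b). {a, b} \<in> E}" by (auto simp: sym_def insert_commute)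
  then show "(u, v) \<in> linked E \<Longrightarrow> (v, u) \<in> linked E"
    unfolding linked_def by (meson sym_rtrancl symD)
qed

lemma linked_mono: "E \<subseteq> F \<Longrightarrow> linked E \<subseteq> linked F"
  unfolding linked_def by (rule rtrancl_mono) auto

lemma linked_trans: "(u, v) \<in> linked E \<Longrightarrow> (v, w) \<in> linked E \<Longrightarrow> (u, w) \<in> linked E"
  unfolding linked_def by (rule rtrancl_trans)

lemma linked_edge: "{u, v} \<in> E \<Longrightarrow> (u, v) \<in> linked E"
  unfolding linked_def by (rule r_into_rtrancl) auto

lemma root_of_connected:
  assumes "connected_graph n F" "v \<in> {1..n+1}"
  shows "root_of n F v = n + 1"
proof -
  have "{w \<in> {1..n+1}. (v, w) \<in> linked F} = {1..n+1}"
    using assms by (auto simp: connected_graph_def)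
  then show ?thesis unfolding root_of_def by (simp add: Max_eq_iff)
qed

lemma linked_graph_path:
  assumes "(u, v) \<in> linked E"
  shows "\<exists>p. graph_path E p \<and> hd p = u \<and> last p = v"
  using assms unfolding linked_def
proof (induction rule: converse_rtrancl_induct)
  case base
  show ?case by (rule exI[of _ "[v]"]) (simp add: graph_path_def)
next
  case (step x y)
  then obtain p where p: "graph_path E p" "hd p = y" "last p = v" by blast
  show ?case
  proof (cases "x \<in> set p")
    case True
    then obtain ys zs where eq: "p = ys @ x # zs" by (meson split_list)
    with p have "graph_path E (x # zs)"
      by (auto simp: graph_path_def successively_append_iff)
    with p eq show ?thesis by (intro exI[of _ "x # zs"]) auto
  next
    case False
    with p step show ?thesis
      by (intro exI[of _ "x # p"]) (auto simp: graph_path_def successively_Cons)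
  qed
qed

text \<open>The label \<open>n + 1\<close> is the only one without a parent, hence the root. The
  rank is any measure that decreases towards the root: it rules out cycles and carries the
  inductions; for a search it will be the time of activation.\<close>

locale parent_tree =
  fixes n :: nat and par :: "nat \<Rightarrow> nat" and r :: "nat \<Rightarrow> nat" and T :: "nat set set"
  assumes par_in: "v \<in> {1..n} \<Longrightarrow> par v \<in> {1..n+1}"
    and par_rank: "v \<in> {1..n} \<Longrightarrow> r (par v) < r v"
    and T_eq: "T = (\<lambda>v. {v, par v}) ` {1..n}"
begin

lemma edge_iff: "{u, v} \<in> T \<longleftrightarrow> (u \<in> {1..n} \<and> v = par u) \<or> (v \<in> {1..n} \<and> u = par v)"
  unfolding T_eq by (auto simp: doubleton_eq_iff)

lemma par_neq: "v \<in> {1..n} \<Longrightarrow> par v \<noteq> v"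
  using par_rank[of v] by auto

lemma labeled: "labeled_graph n T"
proof -
  have "{v, par v} \<subseteq> {1..n+1} \<and> card {v, par v} = 2" if "v \<in> {1..n}" for v
    using par_neq[OF that] par_in[OF that] that by auto
  then show ?thesis unfolding labeled_graph_def T_eq by blast
qed

text \<open>Climbing from parent to parent lowers the rank, so no node is repeated. The last
  conjunct fixes the second node, which is what \<open>parent_of\<close> asks for.\<close>

lemma path_to_root:
  assumes "v \<in> {1..n+1}"
  shows "\<exists>p. graph_path T (v # p) \<and> last (v # p) = n + 1 \<and> (\<forall>w\<in>set p. r w < r v)
           \<and> (v \<noteq> n + 1 \<longrightarrow> p \<noteq> [] \<and> hd p = par v)"
  using assms
proof (induction "r v" arbitrary: v rule: less_induct)
  case less
  show ?case
  proof (cases "v = n + 1")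
    case True
    then show ?thesis by (intro exI[of _ "[]"]) (auto simp: graph_path_def)
  next
    case False
    with less have v: "v \<in> {1..n}" by auto
    obtain p where p: "graph_path T (par v # p)" "last (par v # p) = n + 1"
      "\<forall>w\<in>set p. r w < r (par v)"
      using less(1)[OF par_rank[OF v] par_in[OF v]] by blast
    have "{v, par v} \<in> T" using v by (auto simp: edge_iff)
    moreover have "\<forall>w\<in>set (par v # p). r w < r v" using p(3) par_rank[OF v] by auto
    ultimately show ?thesis using p
      by (intro exI[of _ "par v # p"]) (auto simp: graph_path_def)
  qed
qed

lemma linked_root: "v \<in> {1..n+1} \<Longrightarrow> (v, n + 1) \<in> linked T"
proof (induction "r v" arbitrary: v rule: less_induct)
  case less
  show ?case
  proof (cases "v = n + 1")
    case True
    then show ?thesis by (simp add: linked_def)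
  next
    case False
    with less have v: "v \<in> {1..n}" by auto
    have "(v, par v) \<in> linked T" using v by (intro linked_edge) (auto simp: edge_iff)
    with less(1)[OF par_rank[OF v] par_in[OF v]] show ?thesis by (meson linked_trans)
  qed
qed

lemma connected: "connected_graph n T"
  unfolding connected_graph_def using labeled linked_root by (meson linked_sym linked_trans)

text \<open>A node of maximal rank on a cycle would have two different parents.\<close>

lemma acyclic_tree: "\<not> has_cycle T"
proof
  assume "has_cycle T"
  then obtain p where p: "graph_path T p" "3 \<le> length p" "{last p, hd p} \<in> T"
    by (auto simp: has_cycle_def)
  define l where "l = length p"
  have d: "distinct p" and s: "successively (\<lambda>a b. {a, b} \<in> T) p" and ne: "p \<noteq> []"
    using p by (auto simp: graph_path_def)
  have l3: "l \<ge> 3" using p l_def by simp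
  have step: "{p ! i, p ! ((i + 1) mod l)} \<in> T" if "i < l" for i
  proof (cases "i + 1 < l")
    case True
    then show ?thesis using successively_nthD[OF s, of i] by (simp add: l_def)
  next
    case False
    then have "i = l - 1" using that by simp
    then show ?thesis using p(3) ne l3 that by (simp add: last_conv_nth hd_conv_nth l_def)
  qed
  obtain i where i: "i < l" "\<forall>k<l. r (p ! k) \<le> r (p ! i)"
  proof -
    have "\<exists>m. m < l \<and> (\<forall>y. y < l \<longrightarrow> r (p ! y) \<le> r (p ! m))"
      by (rule ex_has_greatest_nat[of "\<lambda>k. k < l" 0 "\<lambda>k. r (p ! k)" "Suc (Max ((\<lambda>k. r (p ! k)) ` {..<l}))"])
        (use l3 in \<open>auto intro!: le_imp_less_Suc\<close>)
    then show ?thesis using that by blast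
  qed
  have up: "y = par (p ! i)" if "{p ! i, y} \<in> T" "k < l" "y = p ! k" for y k
    using that i par_rank[of y] unfolding edge_iff by (auto dest!: spec[of _ k])
  define a b where "a = (i + 1) mod l" and "b = (i + l - 1) mod l"
  have ab: "a < l" "b < l" using l3 by (auto simp: a_def b_def)
  have b1: "(b + 1) mod l = i"
    using i(1) l3 by (simp add: b_def mod_Suc_eq)
  have "{p ! b, p ! i} \<in> T" using step[OF ab(2)] b1 by simp
  then have "{p ! i, p ! b} \<in> T" by (simp add: insert_commute)
  moreover have "{p ! i, p ! a} \<in> T" using step[OF i(1)] by (simp add: a_def)
  ultimately have "p ! a = p ! b" using up ab by metis
  then have "a = b" using d ab by (simp add: nth_eq_iff_index_eq l_def)
  moreover have "a \<noteq> b"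
  proof (cases "i = 0")
    case True then show ?thesis using l3 by (simp add: a_def b_def)
  next
    case i0: False
    have "b = i - 1"
      using i0 i(1) by (cases i) (auto simp: b_def)
    then show ?thesis using i0 i(1) l3 by (cases "i + 1 = l") (auto simp: a_def)
  qed
  ultimately show False by simp
qed

lemma tree: "labeled_tree n T"
  using connected acyclic_tree by (simp add: labeled_tree_def)

text \<open>After a step down to a child, the parent is used up, so a path can only descend further,
  and \<open>n + 1\<close> is the child of no node. Hence a path to the root cannot begin with a
  step down, which identifies \<open>parent_of\<close>.\<close>

lemma downward_path:
  assumes "graph_path T (v # u # p)" "u \<in> {1..n}" "v = par u"
  shows "last (v # u # p) \<noteq> n + 1"
  using assms
proof (induction p arbitrary: u v)
  case Nil
  then show ?case by auto
next
  case (Cons w p)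
  from Cons.prems have "{u, w} \<in> T" "w \<noteq> v" "graph_path T (u # w # p)"
    by (auto simp: graph_path_def)
  with Cons.IH[of u w] Cons.prems show ?case by (auto simp: edge_iff)
qed

lemma parent_of_iff: "parent_of n T u v \<longleftrightarrow> v \<in> {1..n} \<and> u = par v"
proof
  assume "parent_of n T u v"
  then obtain p where p: "graph_path T (v # u # p)" "last (v # u # p) = root_of n T v"
    by (auto simp: parent_of_def)
  then have e: "{v, u} \<in> T" by (auto simp: graph_path_def)
  then have "v \<in> {1..n+1}" using par_in by (auto simp: edge_iff)
  with p have l: "last (v # u # p) = n + 1" by (simp add: root_of_connected[OF connected])
  show "v \<in> {1..n} \<and> u = par v"
    using e downward_path[OF p(1)] l by (auto simp: edge_iff)
next
  assume v: "v \<in> {1..n} \<and> u = par v"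
  then have "v \<in> {1..n+1}" "v \<noteq> n + 1" by auto
  from path_to_root[OF this(1)] this(2) obtain p where
    "graph_path T (v # p)" "last (v # p) = n + 1" "p \<noteq> []" "hd p = par v" by blast
  then show "parent_of n T u v"
    unfolding parent_of_def using v root_of_connected[OF connected \<open>v \<in> {1..n+1}\<close>]
    by (intro exI[of _ "tl p"]) (cases p; auto)
qed

lemma children_iff: "v \<in> children n T u \<longleftrightarrow> v \<in> {1..n} \<and> u = par v"
  unfolding children_def parent_of_iff by auto

end

text \<open>The indexed definition becomes a recursion on the list. The second alternative is the
  shortest cane path \<open>[v, u, w]\<close>, one step up and one down to the right; a longer one
  is a step up followed by a cane path.\<close>

lemma cane_path_Cons:
  "cane_path n F (v # vs) \<longleftrightarrow>
     v \<in> {1..n+1} \<and> (\<exists>u us. vs = u # us \<and> parent_of n F u v \<and>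
       (cane_path n F vs \<or> u \<in> {1..n+1} \<and> (\<exists>w. us = [w] \<and> w \<in> children n F u \<and> v < w)))"
  (is "?L \<longleftrightarrow> ?R")
proof
  assume ?L
  then obtain k where k: "k \<ge> 2" "length (v # vs) = k + 1" "set (v # vs) \<subseteq> {1..n+1}"
    "\<forall>i<k - 1. parent_of n F ((v # vs) ! (i + 1)) ((v # vs) ! i)"
    "(v # vs) ! k \<in> children n F ((v # vs) ! (k - 1))" "(v # vs) ! (k - 2) < (v # vs) ! k"
    unfolding cane_path_def by blast
  then obtain u us where vs: "vs = u # us" by (cases vs) auto
  have p: "parent_of n F u v" using k(1,4) vs by (auto dest!: spec[of _ 0])
  show ?R
  proof (cases "k = 2")
    case True
    then obtain w where "us = [w]" using k(2) vs by (cases us) auto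
    with k p vs True show ?thesis by auto
  next
    case False
    then obtain k' where k': "k = Suc k'" "k' \<ge> 2" using k(1) by (cases k) auto
    have "cane_path n F vs"
      unfolding cane_path_def
    proof (intro exI[of _ k'] conjI allI impI)
      fix i assume "i < k' - 1"
      then show "parent_of n F (vs ! (i + 1)) (vs ! i)"
        using k(4) k' by (auto dest!: spec[of _ "Suc i"])
    qed (use k k' in \<open>auto simp: nth_Cons' numeral_2_eq_2 split: if_splits\<close>)
    with p vs k show ?thesis by auto
  qed
next
  assume R: ?R
  then obtain u us where vs: "vs = u # us" and p: "parent_of n F u v" and v: "v \<in> {1..n+1}"
    and c: "cane_path n F vs \<or> u \<in> {1..n+1} \<and> (\<exists>w. us = [w] \<and> w \<in> children n F u \<and> v < w)" by blast
  from c show ?L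
  proof
    assume "cane_path n F vs"
    then obtain k where k: "k \<ge> 2" "length vs = k + 1" "set vs \<subseteq> {1..n+1}"
      "\<forall>i<k - 1. parent_of n F (vs ! (i + 1)) (vs ! i)"
      "vs ! k \<in> children n F (vs ! (k - 1))" "vs ! (k - 2) < vs ! k"
      unfolding cane_path_def by blast
    show ?thesis
      unfolding cane_path_def
    proof (intro exI[of _ "Suc k"] conjI allI impI)
      fix i assume "i < Suc k - 1"
      then show "parent_of n F ((v # vs) ! (i + 1)) ((v # vs) ! i)"
        using k p vs by (cases i) auto
    qed (use k v in \<open>auto simp: nth_Cons' Suc_diff_le numeral_2_eq_2\<close>)
  next
    assume "u \<in> {1..n+1} \<and> (\<exists>w. us = [w] \<and> w \<in> children n F u \<and> v < w)"
    then obtain w where "us = [w]" "w \<in> children n F u" "v < w" "u \<in> {1..n+1}" by blast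
    then show ?thesis
      unfolding cane_path_def using vs p v
      by (intro exI[of _ 2]) (auto simp: children_def)
  qed
qed

lemma cane_path_Nil: "\<not> cane_path n F []"
  by (auto simp: cane_path_def)

context parent_tree
begin

lemma canes_root: "{vs. cane_path n T vs \<and> hd vs = n + 1} = {}"
proof -
  have "\<not> cane_path n T vs" if "hd vs = n + 1" for vs
    using that by (cases vs) (auto simp: cane_path_Nil cane_path_Cons parent_of_iff)
  then show ?thesis by auto
qed

lemma canes_child:
  assumes v: "v \<in> {1..n}"
  shows "{vs. cane_path n T vs \<and> hd vs = v} =
    (\<lambda>w. [v, par v, w]) ` {w \<in> {1..n}. par w = par v \<and> v < w} \<union>
    (#) v ` {vs. cane_path n T vs \<and> hd vs = par v}" (is "?A = ?B")
proof (rule set_eqI)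
  fix vs
  show "vs \<in> ?A \<longleftrightarrow> vs \<in> ?B"
  proof (cases vs)
    case Nil
    then show ?thesis by (auto simp: cane_path_Nil)
  next
    case (Cons x us)
    have "vs \<in> ?A \<longleftrightarrow> x = v \<and> cane_path n T (v # us)" using Cons by auto
    also have "\<dots> \<longleftrightarrow> vs \<in> ?B"
      unfolding cane_path_Cons Cons using v par_in[OF v]
      by (cases us) (auto simp: parent_of_iff children_iff cane_path_Nil)
    finally show ?thesis .
  qed
qed

lemma finite_canes: "v \<in> {1..n+1} \<Longrightarrow> finite {vs. cane_path n T vs \<and> hd vs = v}"
proof (induction "r v" arbitrary: v rule: less_induct)
  case less
  show ?case
  proof (cases "v = n + 1")
    case True
    then show ?thesis by (simp only: canes_root) simp
  next
    case False
    with less have v: "v \<in> {1..n}" by auto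
    show ?thesis
      unfolding canes_child[OF v] using less(1)[OF par_rank[OF v] par_in[OF v]] by simp
  qed
qed

lemma canes_from_root: "canes_from n T (n + 1) = 0"
  unfolding canes_from_def canes_root by simp

text \<open>At the parent, a cane path either turns down to a larger sibling or climbs on. The stack
  obeys the same recursion: a node lies above its larger siblings and above what lay below its
  parent.\<close>

lemma canes_from_child:
  assumes v: "v \<in> {1..n}"
  shows "canes_from n T v = card {w \<in> {1..n}. par w = par v \<and> v < w} + canes_from n T (par v)"
proof -
  \<comment> \<open>A cane path has at least three nodes, so the two kinds of paths are
    disjoint.\<close>
  have "\<not> cane_path n T [par v, w]" for w
    by (simp add: cane_path_def)
  then have "(\<lambda>w. [v, par v, w]) ` {w \<in> {1..n}. par w = par v \<and> v < w} \<inter>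
    (#) v ` {vs. cane_path n T vs \<and> hd vs = par v} = {}" by auto
  then show ?thesis
    unfolding canes_from_def canes_child[OF v] using finite_canes[OF par_in[OF v]]
    by (subst card_Un_disjoint) (auto simp: card_image inj_on_def)
qed

lemma cane_number_sum: "cane_number n T = (\<Sum>v\<in>{1..n+1}. canes_from n T v)"
proof -
  have "{vs. cane_path n T vs} = (\<Union>v\<in>{1..n+1}. {vs. cane_path n T vs \<and> hd vs = v})"
  proof safe
    fix vs assume c: "cane_path n T vs"
    then obtain v us where "vs = v # us" by (cases vs) (auto simp: cane_path_Nil)
    with c show "vs \<in> (\<Union>v\<in>{1..n+1}. {vs. cane_path n T vs \<and> hd vs = v})"
      using cane_path_Cons by auto
  qed
  then show ?thesis
    unfolding cane_number_def canes_from_def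
    using finite_canes by (simp add: card_UN_disjoint disjoint_iff)
qed

end

section \<open>Search with a stack\<close>

text \<open>
  \<open>S m\<close> holds, top first, the visited nodes that are waiting while the \<open>m\<close>-th active node \<open>a m\<close>
  finds the new nodes \<open>C m\<close>; \<open>V m\<close> lists the nodes visited before that.
\<close>

locale search_prefix =
  fixes n N :: nat and C :: "nat \<Rightarrow> nat set" and V :: "nat \<Rightarrow> nat list"
    and a :: "nat \<Rightarrow> nat" and S :: "nat \<Rightarrow> nat list"
  assumes V0: "V 0 = [n + 1]" and a0: "a 0 = n + 1" and S0: "S 0 = []"
    and V_Suc: "m < N \<Longrightarrow> V (Suc m) = V m @ rev (sorted_list_of_set (C m))"
    and aS_Suc: "m < N \<Longrightarrow> a (Suc m) # S (Suc m) = sorted_list_of_set (C m) @ S m"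
    and C_new: "m < N \<Longrightarrow> C m \<subseteq> {1..n} - set (V m)"
begin

lemma finite_C: "m < N \<Longrightarrow> finite (C m)"
  using C_new finite_subset by blast

text \<open>A visited node either has been active or is waiting on the stack. Multisets are compared
  because the two sides list these nodes in different orders; distinctness of \<open>V m\<close>
  then passes to the active nodes and the stack.\<close>

lemma V_invariant:
  "m \<le> N \<Longrightarrow> distinct (V m) \<and> mset (V m) = mset (map a [0..<Suc m] @ S m)
      \<and> set (V m) = insert (n + 1) (\<Union>k<m. C k) \<and> set (V m) \<subseteq> {1..n+1}"
proof (induction m)
  case 0
  then show ?case by (simp add: V0 a0 S0)
next
  case (Suc m)
  then have m: "m < N" by simp
  have "mset (map a [0..<Suc (Suc m)] @ S (Suc m)) =
      mset (map a [0..<Suc m]) + mset (a (Suc m) # S (Suc m))" by simp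
  also have "\<dots> = mset (map a [0..<Suc m]) + mset (sorted_list_of_set (C m) @ S m)"
    by (simp only: aS_Suc[OF m])
  finally have 1: "mset (V (Suc m)) = mset (map a [0..<Suc (Suc m)] @ S (Suc m))"
    using Suc.IH m finite_C[OF m] by (simp add: V_Suc[OF m])
  have 2: "set (V (Suc m)) = C m \<union> set (V m)"
    using finite_C[OF m] by (auto simp: V_Suc[OF m])
  have 3: "distinct (V (Suc m))"
    using Suc.IH m finite_C[OF m] C_new[OF m] by (auto simp: V_Suc[OF m])
  have 4: "set (V (Suc m)) = insert (n + 1) (\<Union>k<Suc m. C k)"
    using Suc.IH m unfolding 2 lessThan_Suc by simp
  have "C m \<subseteq> {1..n+1}" using C_new[OF m] by auto
  then have "set (V (Suc m)) \<subseteq> {1..n+1}"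
    using Suc.IH[OF Suc_leD[OF Suc.prems]] unfolding 2 by blast
  with 1 3 4 show ?case by blast
qed

lemma distinct_V: "m \<le> N \<Longrightarrow> distinct (V m)"
  and V_subset: "m \<le> N \<Longrightarrow> set (V m) \<subseteq> {1..n+1}"
  and set_V_C: "m \<le> N \<Longrightarrow> set (V m) = insert (n + 1) (\<Union>k<m. C k)"
  using V_invariant by auto

lemma distinct_aS: "m \<le> N \<Longrightarrow> distinct (map a [0..<Suc m] @ S m)"
  using V_invariant[of m] mset_eq_imp_distinct_iff[of "V m" "map a [0..<Suc m] @ S m"] by simp

lemma length_V: "m \<le> N \<Longrightarrow> length (V m) = Suc m + length (S m)"
  using mset_eq_length[of "V m" "map a [0..<Suc m] @ S m"] V_invariant[of m] by simp

lemma set_V: "m \<le> N \<Longrightarrow> set (V m) = a ` {..m} \<union> set (S m)"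
proof -
  assume "m \<le> N"
  then have "set (V m) = set (map a [0..<Suc m] @ S m)" using V_invariant mset_eq_setD by blast
  also have "\<dots> = a ` {..m} \<union> set (S m)" by (simp add: atLeast0LessThan lessThan_Suc_atMost del: upt_Suc)
  finally show ?thesis .
qed

lemma a_eq_iff: "i \<le> N \<Longrightarrow> k \<le> N \<Longrightarrow> a i = a k \<longleftrightarrow> i = k"
  using distinct_aS[of N] by (auto simp: distinct_map inj_on_def simp del: upt_Suc)

lemma a_notin_S: "k \<le> m \<Longrightarrow> m \<le> N \<Longrightarrow> a k \<notin> set (S m)"
  using distinct_aS[of m] by (auto simp: disjoint_iff simp del: upt_Suc)

lemma V_prefix: "m \<le> m' \<Longrightarrow> m' \<le> N \<Longrightarrow> \<exists>us. V m' = V m @ us"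
proof (induction m' rule: dec_induct)
  case (step k)
  then show ?case by (auto simp: V_Suc)
qed auto

lemma V_mono: "m \<le> m' \<Longrightarrow> m' \<le> N \<Longrightarrow> set (V m) \<subseteq> set (V m')"
  using V_prefix by fastforce

lemma C_V_Suc: "m < N \<Longrightarrow> set (V (Suc m)) = set (V m) \<union> C m"
  using finite_C by (simp add: V_Suc)

lemma length_S_Suc: "m < N \<Longrightarrow> Suc (length (S (Suc m))) = card (C m) + length (S m)"
  using arg_cong[OF aS_Suc, of m length] finite_C[of m] by simp

lemma C_disjoint: "m < m' \<Longrightarrow> m' < N \<Longrightarrow> C m \<inter> C m' = {}"
  using V_mono[of "Suc m" m'] C_V_Suc[of m] C_new[of m'] by auto

lemma C_unique: "m < N \<Longrightarrow> m' < N \<Longrightarrow> v \<in> C m \<Longrightarrow> v \<in> C m' \<Longrightarrow> m = m'"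
  using C_disjoint[of m m'] C_disjoint[of m' m] by (cases m m' rule: linorder_cases) auto

text \<open>Nodes are pushed in the order in which they are visited, so the waiting nodes in search
  order are the stack read from the bottom. Its top is therefore the most recently visited waiting
  node that \<open>nfs_step\<close> selects.\<close>

lemma waiting_eq: "m \<le> N \<Longrightarrow> filter (\<lambda>v. v \<notin> a ` {..m}) (V m) = rev (S m)"
proof (induction m)
  case 0
  then show ?case by (simp add: V0 a0 S0)
next
  case (Suc m)
  then have m: "m < N" by simp
  let ?new = "sorted_list_of_set (C m)"
  have "filter (\<lambda>v. v \<notin> a ` {..Suc m}) (V (Suc m)) =
      filter (\<lambda>v. v \<noteq> a (Suc m)) (filter (\<lambda>v. v \<notin> a ` {..m}) (V m @ rev ?new))"
    by (simp add: V_Suc[OF m] atMost_Suc conj_commute)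
  also have "filter (\<lambda>v. v \<notin> a ` {..m}) (rev ?new) = rev ?new"
    using C_new[OF m] set_V[of m] m finite_C[OF m] by (intro filter_True) auto
  then have "filter (\<lambda>v. v \<notin> a ` {..m}) (V m @ rev ?new) = rev (?new @ S m)"
    using Suc by simp
  also have "\<dots> = rev (S (Suc m)) @ [a (Suc m)]"
    by (simp only: aS_Suc[OF m, symmetric] rev.simps)
  also have "filter (\<lambda>v. v \<noteq> a (Suc m)) \<dots> = rev (S (Suc m))"
    using a_notin_S[of "Suc m" "Suc m"] Suc.prems by (auto intro!: filter_True)
  finally show ?case .
qed

definition forest :: "nat \<Rightarrow> nat set set" where
  "forest m = (\<Union>k<m. (\<lambda>w. {a k, w}) ` C k)"

text \<open>By \<open>aS_Suc\<close>, new nodes and stack are not both empty, so the third branch of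
  \<open>nfs_step\<close>, the start of another component, is never taken within the prefix.\<close>

lemma nfs_iterate:
  assumes adj: "\<And>m. m < N \<Longrightarrow> adj (a m) - set (V m) = C m"
  shows "m \<le> N \<Longrightarrow> (nfs_step n adj ^^ m) (nfs_init n) =
    \<lparr> visited = V m, activated = a ` {..m}, active = a m, search_edges = forest m \<rparr>"
proof (induction m)
  case 0
  then show ?case by (simp add: nfs_init_def V0 a0 forest_def)
next
  case (Suc m)
  then have m: "m < N" by simp
  have edges: "forest (Suc m) = forest m \<union> {{a m, w} |w. w \<in> C m}"
    by (auto simp: forest_def lessThan_Suc)
  let ?s = "\<lparr> visited = V m, activated = a ` {..m}, active = a m, search_edges = forest m \<rparr>"
  have "nfs_step n adj ?s = \<lparr> visited = V (Suc m), activated = a ` {..Suc m},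
    active = a (Suc m), search_edges = forest (Suc m) \<rparr>"
  proof (cases "C m = {}")
    case True
    with aS_Suc[OF m] have S: "S m = a (Suc m) # S (Suc m)" by simp
    then show ?thesis
      using waiting_eq[of m] m True V_Suc[OF m] unfolding edges
      by (simp add: nfs_step_def adj[OF m] Let_def atMost_Suc)
  next
    case False
    have "a (Suc m) = hd (sorted_list_of_set (C m) @ S m)"
      by (simp only: aS_Suc[OF m, symmetric] list.sel)
    also have "\<dots> = Min (C m)"
      using False finite_C[OF m] by (cases "sorted_list_of_set (C m)")
        (auto simp: sorted_list_of_set_nonempty)
    finally show ?thesis
      using False V_Suc[OF m] unfolding edges
      by (simp add: nfs_step_def adj[OF m] Let_def atMost_Suc)
  qed
  then show ?case using Suc by simp
qed

end

locale search_run = search_prefix n n C V a S for n C V a S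
begin

text \<open>After \<open>n\<close> steps, \<open>n + 1\<close> distinct nodes have been active, so
  no label is left to wait or to be visited.\<close>

lemma S_end: "S n = []" and set_V_end: "set (V n) = {1..n+1}" and length_V_end: "length (V n) = n + 1"
proof -
  have "length (V n) = card (set (V n))" using distinct_V[of n] by (simp add: distinct_card)
  also have "\<dots> \<le> card {1..n+1}" using V_subset[of n] by (intro card_mono) auto
  finally show "S n = []" "length (V n) = n + 1" using length_V[of n] by auto
  then have "card (set (V n)) = card {1..n+1}" using distinct_card[OF distinct_V[of n]] by simp
  then show "set (V n) = {1..n+1}"
    using V_subset[of n] by (intro card_subset_eq) auto
qed

lemma a_image: "a ` {..n} = {1..n+1}"
proof -
  have "{1..n+1} = a ` {..n} \<union> set (S n)" by (subst set_V_end[symmetric], rule set_V) simp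
  then show ?thesis by (simp add: S_end)
qed

lemma C_cover: "{1..n} = (\<Union>m<n. C m)"
proof -
  have "insert (n + 1) (\<Union>m<n. C m) = {1..n+1}" using set_V_C[of n] set_V_end by simp
  moreover have "(\<Union>m<n. C m) \<subseteq> {1..n}" using C_new by blast
  then have "n + 1 \<notin> (\<Union>m<n. C m)" by auto
  moreover have "{1..n} = {1..n+1} - {n + 1}" by auto
  ultimately show ?thesis by (metis Diff_insert_absorb)
qed

definition tree_par :: "nat \<Rightarrow> nat" where
  "tree_par v = a (THE m. m < n \<and> v \<in> C m)"

definition rank :: "nat \<Rightarrow> nat" where
  "rank v = (THE k. k \<le> n \<and> a k = v)"

abbreviation tree :: "nat set set" where
  "tree \<equiv> forest n"

lemma tree_par_C: "m < n \<Longrightarrow> v \<in> C m \<Longrightarrow> tree_par v = a m"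
  unfolding tree_par_def by (rule arg_cong[of _ _ a], rule the_equality) (auto dest: C_unique)

lemma rank_a: "k \<le> n \<Longrightarrow> rank (a k) = k"
  unfolding rank_def by (rule the_equality) (auto simp: a_eq_iff)

lemma C_activated_later: "m < n \<Longrightarrow> k \<le> n \<Longrightarrow> a k \<in> C m \<Longrightarrow> m < k"
  by (rule ccontr) (use C_new[of m] set_V[of m] in \<open>auto simp: not_less\<close>)

text \<open>A child is found while its parent is active and becomes active only later, so the time
  of activation is a rank.\<close>

sublocale parent_tree n tree_par rank tree
proof
  fix v assume "v \<in> {1..n}"
  then obtain m where m: "m < n" "v \<in> C m" using C_cover by blast
  have "v \<in> a ` {..n}" using \<open>v \<in> {1..n}\<close> a_image by simp
  then obtain k where k: "k \<le> n" "v = a k" by auto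
  show "tree_par v \<in> {1..n+1}"
    using m a_image by (auto simp: tree_par_C)
  show "rank (tree_par v) < rank v"
    using m k C_activated_later[of m k] tree_par_C[OF m] rank_a[of m] rank_a[of k] by simp
next
  show "tree = (\<lambda>v. {v, tree_par v}) ` {1..n}"
  proof -
    have "(\<lambda>w. {a k, w}) ` C k = (\<lambda>v. {v, tree_par v}) ` C k" if "k < n" for k
      using that by (intro image_cong) (simp_all add: tree_par_C insert_commute)
    then show ?thesis unfolding C_cover forest_def image_UN by simp
  qed
qed

lemma children_a: "m < n \<Longrightarrow> children n tree (a m) = C m"
proof -
  assume m: "m < n"
  have "v \<in> {1..n} \<and> a m = tree_par v \<longleftrightarrow> v \<in> C m" for v
  proof
    assume v: "v \<in> {1..n} \<and> a m = tree_par v"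
    then obtain m' where m': "m' < n" "v \<in> C m'" using C_cover by blast
    with v have "a m = a m'" by (simp add: tree_par_C)
    with m m' show "v \<in> C m" by (simp add: a_eq_iff)
  next
    assume "v \<in> C m"
    with m show "v \<in> {1..n} \<and> a m = tree_par v" using C_new[OF m] by (auto simp: tree_par_C)
  qed
  then show ?thesis unfolding set_eq_iff children_iff by blast
qed

text \<open>Only unvisited candidates matter to a search. Hence one run describes the search of a
  graph and also the search of its search tree along children, on which \<open>nfs_position\<close>
  is based.\<close>

lemma nfs_eq:
  assumes adj: "\<And>m. m < n \<Longrightarrow> adj (a m) - set (V m) = C m"
  shows "nfs n adj =
    \<lparr> visited = V n, activated = a ` {..n}, active = a n, search_edges = tree \<rparr>"
  unfolding nfs_def by (rule nfs_iterate[OF adj]) auto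

lemma children_new: "m < n \<Longrightarrow> children n tree (a m) - set (V m) = C m"
  using C_new[of m] by (auto simp: children_a)

lemma nfs_children: "visited (nfs n (children n tree)) = V n"
  using nfs_eq[OF children_new] by simp

abbreviation cane :: "nat \<Rightarrow> nat" where
  "cane \<equiv> canes_from n tree"

text \<open>The cane paths from a node end at the nodes below it in the stack.\<close>

lemma cane_stack: "m \<le> n \<Longrightarrow> a m # S m = ys @ x # xs \<Longrightarrow> cane x = length xs"
proof (induction m arbitrary: ys x xs)
  case 0
  then have "x = n + 1" "xs = []" by (cases ys; simp add: a0 S0)+
  then show ?case using canes_from_root by simp
next
  case (Suc m)
  then have m: "m < n" by simp
  let ?new = "sorted_list_of_set (C m)"
  have cm: "cane (a m) = length (S m)" using Suc.IH[of "[]" "a m" "S m"] Suc.prems(1) by simp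
  have "?new @ S m = ys @ x # xs" using Suc.prems(2) unfolding aS_Suc[OF m] .
  then consider us where "S m = us @ x # xs" | zs where "?new = ys @ x # zs" "xs = zs @ S m"
  proof -
    assume "?new @ S m = ys @ x # xs"
    then obtain us where "?new = ys @ us \<and> us @ S m = x # xs \<or> ?new @ us = ys \<and> S m = us @ x # xs"
      unfolding append_eq_append_conv2 by blast
    then show thesis using that by (cases us) auto
  qed
  then show ?case
  proof cases
    case 1
    then show ?thesis using Suc.IH[of "a m # us" x xs] m by simp
  next
    case 2
    have xC: "x \<in> C m" using arg_cong[OF 2(1), of set] finite_C[OF m] by simp
    then have x: "x \<in> {1..n}" using C_new[OF m] by auto
    have new: "sorted (ys @ x # zs)" "distinct (ys @ x # zs)" "set (ys @ x # zs) = C m"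
      unfolding 2(1)[symmetric] using finite_C[OF m] by simp_all
    \<comment> \<open>The larger siblings of \<open>x\<close> are its successors in the sorted list
      and lie directly below it; under them lies the stack of its parent.\<close>
    have "{w \<in> {1..n}. tree_par w = tree_par x \<and> x < w} = {w \<in> C m. x < w}"
      unfolding tree_par_C[OF m xC] children_a[OF m, symmetric] children_iff by auto
    also have "\<dots> = set zs"
    proof -
      have le: "\<forall>w\<in>set ys. w \<le> x" "\<forall>w\<in>set zs. x \<le> w" "x \<notin> set zs"
        using new(1,2) by (auto simp: sorted_append)
      have "w \<in> C m \<longleftrightarrow> w \<in> set ys \<or> w = x \<or> w \<in> set zs" for w
        unfolding new(3)[symmetric] by auto
      then have "{w \<in> C m. x < w} = {w. (w \<in> set ys \<or> w = x \<or> w \<in> set zs) \<and> x < w}" by blast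
      also have "\<dots> = set zs" using le by (auto simp: less_le)
      finally show ?thesis .
    qed
    finally have "card {w \<in> {1..n}. tree_par w = tree_par x \<and> x < w} = length zs"
      using new(2) by (simp add: distinct_card)
    then show ?thesis using 2(2) by (simp add: canes_from_child[OF x] tree_par_C[OF m xC] cm)
  qed
qed

lemma cane_a: "m \<le> n \<Longrightarrow> cane (a m) = length (S m)"
  using cane_stack[of m "[]" "a m" "S m"] by simp

text \<open>New nodes are pushed from the largest to the smallest, the first on the old stack and
  each further one on its predecessor.\<close>

lemma cane_new:
  assumes m: "m < n" and i: "i < card (C m)"
  shows "cane (rev (sorted_list_of_set (C m)) ! i) = length (S m) + i"
proof -
  let ?new = "sorted_list_of_set (C m)"
  let ?k = "card (C m) - Suc i"
  have l: "length ?new = card (C m)" by simp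
  have "?new = take ?k ?new @ ?new ! ?k # drop (Suc ?k) ?new"
    using i l by (intro id_take_nth_drop) simp
  then have "?new @ S m = (take ?k ?new @ ?new ! ?k # drop (Suc ?k) ?new) @ S m"
    by (rule arg_cong)
  then have "a (Suc m) # S (Suc m) = take ?k ?new @ ?new ! ?k # (drop (Suc ?k) ?new @ S m)"
    unfolding aS_Suc[OF m] append_assoc append_Cons .
  then have "cane (?new ! ?k) = length (drop (Suc ?k) ?new @ S m)"
    by (intro cane_stack[of "Suc m"]) (use m in auto)
  then show ?thesis using i by (simp add: rev_nth)
qed

lemma V_end_nth:
  assumes "m < n" "i < card (C m)"
  shows "V n ! (length (V m) + i) = rev (sorted_list_of_set (C m)) ! i"
proof -
  obtain us where "V n = V (Suc m) @ us" using V_prefix[of "Suc m" n] assms by auto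
  then show ?thesis using assms by (simp add: V_Suc nth_append)
qed

text \<open>If step \<open>m\<close> finds nothing, the stack loses an entry and the next label is
  left to a later step. The step that finds it puts it directly on the stack of that moment. The
  induction runs backwards from the end of the search.\<close>

lemma cane_next: "m \<le> n \<Longrightarrow> length (V m) \<le> n \<Longrightarrow> cane (V n ! length (V m)) \<le> length (S m)"
proof (induction m rule: inc_induct)
  case base
  then show ?case by (simp add: length_V_end)
next
  case (step m)
  show ?case
  proof (cases "C m = {}")
    case True
    with step V_Suc[of m] length_S_Suc[of m] show ?thesis by simp
  next
    case False
    then have "0 < card (C m)" using step finite_C[of m] by (simp add: card_gt_0_iff)
    with V_end_nth[of m 0] cane_new[of m 0] step show ?thesis by simp
  qed
qed

end

text \<open>The longest run of heights \<open>h\<close>, \<open>h + 1\<close>, ... in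
  \<open>L\<close> from position \<open>p\<close> on. With \<open>p\<close> the number of visited
  nodes and \<open>h\<close> the height of the stack, it recovers the new nodes from the search
  order and the heights alone.\<close>

definition batch :: "nat list \<Rightarrow> (nat \<Rightarrow> nat) \<Rightarrow> nat \<Rightarrow> nat \<Rightarrow> nat set" where
  "batch L c p h = {L ! (p + i) | i. p + i < length L \<and> (\<forall>k\<le>i. c (L ! (p + k)) = h + k)}"

text \<open>The condition on consecutive labels of a code. The exception for \<open>n + 1\<close> is
  needed because the root is never on the stack: the node visited after it has height 0 again,
  although its label is smaller.\<close>

definition code_rel :: "nat \<Rightarrow> (nat \<Rightarrow> nat) \<Rightarrow> nat \<Rightarrow> nat \<Rightarrow> bool" where
  "code_rel n c x y \<longleftrightarrow> c y \<le> c x \<or> x \<noteq> n + 1 \<and> c y = Suc (c x) \<and> y < x"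

context search_run
begin

lemma C_batch:
  assumes m: "m < n"
  shows "C m = batch (V n) cane (length (V m)) (length (S m))"
proof (intro equalityI subsetI)
  let ?new = "rev (sorted_list_of_set (C m))"
  have le: "length (V m) + card (C m) \<le> n + 1"
    using V_prefix[of "Suc m" n] m length_V_end finite_C[OF m] by (auto simp: V_Suc)
  fix v assume "v \<in> C m"
  then have "v \<in> set ?new" using finite_C[OF m] by simp
  then obtain i where "i < length ?new" "v = ?new ! i" using in_set_conv_nth[of v ?new] by auto
  then have i: "i < card (C m)" and v: "v = V n ! (length (V m) + i)"
    using V_end_nth[OF m, of i] by simp_all
  have "\<forall>k\<le>i. cane (V n ! (length (V m) + k)) = length (S m) + k"
    using i by (auto simp: V_end_nth[OF m] cane_new[OF m])
  moreover have "length (V m) + i < length (V n)" using i le length_V_end by linarith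
  ultimately show "v \<in> batch (V n) cane (length (V m)) (length (S m))"
    unfolding batch_def v by blast
next
  fix v assume "v \<in> batch (V n) cane (length (V m)) (length (S m))"
  then obtain i where i: "v = V n ! (length (V m) + i)" "length (V m) + i < n + 1"
    "\<And>k. k \<le> i \<Longrightarrow> cane (V n ! (length (V m) + k)) = length (S m) + k"
    unfolding batch_def length_V_end by blast
  have "i < card (C m)"
  proof (rule ccontr)
    \<comment> \<open>By \<open>cane_next\<close>, the label after the new nodes has height at most
      \<open>length (S (Suc m))\<close>, one less than a continued run would require.\<close>
    assume "\<not> i < card (C m)"
    then have ge: "card (C m) \<le> i" by simp
    have "length (V (Suc m)) = length (V m) + card (C m)" by (simp add: V_Suc[OF m])
    with i(2) i(3)[OF ge] ge cane_next[of "Suc m"] m length_S_Suc[OF m] show False by simp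
  qed
  then have "v = rev (sorted_list_of_set (C m)) ! i" "i < length (rev (sorted_list_of_set (C m)))"
    using i(1) V_end_nth[OF m, of i] by simp_all
  then have "v \<in> set (rev (sorted_list_of_set (C m)))" using nth_mem by blast
  then show "v \<in> C m" using finite_C[OF m] by simp
qed

text \<open>Within a batch, heights rise by one while labels decrease. The second conjunct covers
  the passage to the next batch: its first node has height \<open>length (S m)\<close>, which does
  not exceed the height of the last visited node.\<close>

lemma code_V: "m \<le> n \<Longrightarrow> successively (code_rel n cane) (V m) \<and> length (S m) \<le> cane (last (V m))"
proof (induction m)
  case 0
  then show ?case by (simp add: V0 S0)
next
  case (Suc m)
  then have m: "m < n" by simp
  let ?new = "rev (sorted_list_of_set (C m))"
  show ?case
  proof (cases "C m = {}")
    case True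
    then have "V (Suc m) = V m" "length (S (Suc m)) \<le> length (S m)"
      using V_Suc[OF m] length_S_Suc[OF m] by simp_all
    with Suc show ?thesis by simp
  next
    case False
    then have pos: "0 < card (C m)" using finite_C[OF m] by (simp add: card_gt_0_iff)
    have ne: "?new \<noteq> []" using False finite_C[OF m] by simp
    have "cane (hd ?new) = length (S m)"
      using cane_new[OF m pos] unfolding hd_conv_nth[OF ne] by simp
    then have 1: "code_rel n cane (last (V m)) (hd ?new)"
      using Suc.IH[OF less_imp_le[OF m]] unfolding code_rel_def by simp
    have 2: "successively (code_rel n cane) ?new"
      unfolding successively_conv_nth
    proof (intro allI impI)
      fix i assume "Suc i < length ?new"
      then have i: "Suc i < card (C m)" by simp
      have "?new ! i \<in> set ?new" using i by (intro nth_mem) simp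
      then have "?new ! i \<in> C m" using finite_C[OF m] by simp
      then have "?new ! i \<noteq> n + 1" using C_new[OF m] by auto
      moreover have "?new ! Suc i < ?new ! i"
        using i sorted_wrt_nth_less[OF strict_sorted_list_of_set, of "card (C m) - Suc (Suc i)"
            "card (C m) - Suc i" "C m"] by (simp add: rev_nth)
      ultimately show "code_rel n cane (?new ! i) (?new ! Suc i)"
        using cane_new[OF m, of i] cane_new[OF m, of "Suc i"] i unfolding code_rel_def by simp
    qed
    have "hd (sorted_list_of_set (C m)) = a (Suc m)"
      using arg_cong[OF aS_Suc[OF m], of hd] ne by (simp add: hd_append)
    then have "last (V (Suc m)) = a (Suc m)"
      using ne by (simp add: V_Suc[OF m] last_rev)
    then have "length (S (Suc m)) \<le> cane (last (V (Suc m)))"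
      using cane_a[OF Suc.prems] by simp
    moreover have "successively (code_rel n cane) (V (Suc m))"
      unfolding V_Suc[OF m] successively_append_iff using 1 2 Suc.IH[OF less_imp_le[OF m]] by blast
    ultimately show ?thesis by blast
  qed
qed

end

lemma batch_cong:
  assumes "\<And>v. v \<in> set L \<Longrightarrow> c v = c' v"
  shows "batch L c p h = batch L c' p h"
proof -
  have "p + i < length L \<and> (\<forall>k\<le>i. c (L ! (p + k)) = h + k) \<longleftrightarrow>
        p + i < length L \<and> (\<forall>k\<le>i. c' (L ! (p + k)) = h + k)" for i
    using assms by auto
  then show ?thesis unfolding batch_def by simp
qed

text \<open>The rule for the new nodes determines the whole run; by induction the two rules have to
  agree only on states that both runs have reached.\<close>

lemma search_run_unique:
  assumes "search_run n C V a S" "search_run n C' V' a' S'"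
    and eq: "\<And>m. m < n \<Longrightarrow> V m = V' m \<Longrightarrow> a m = a' m \<Longrightarrow> S m = S' m \<Longrightarrow> C m = C' m"
    and "m \<le> n"
  shows "V m = V' m \<and> a m = a' m \<and> S m = S' m"
proof -
  interpret R: search_run n C V a S by fact
  interpret R': search_run n C' V' a' S' by fact
  show ?thesis using \<open>m \<le> n\<close>
  proof (induction m)
    case 0
    show ?case by (simp add: R.V0 R.a0 R.S0 R'.V0 R'.a0 R'.S0)
  next
    case (Suc m)
    then have m: "m < n" and IH: "V m = V' m" "a m = a' m" "S m = S' m" by auto
    have C: "C m = C' m" using eq[OF m IH] .
    have "V (Suc m) = V' (Suc m)" unfolding R.V_Suc[OF m] R'.V_Suc[OF m] IH C ..
    moreover have "a (Suc m) # S (Suc m) = a' (Suc m) # S' (Suc m)"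
      unfolding R.aS_Suc[OF m] R'.aS_Suc[OF m] IH C ..
    ultimately show ?case by simp
  qed
qed

lemma search_run_unique_forest:
  assumes "search_run n C V a S" "search_run n C' V' a' S'"
    and eq: "\<And>m. m < n \<Longrightarrow> V m = V' m \<Longrightarrow> a m = a' m \<Longrightarrow> S m = S' m \<Longrightarrow> C m = C' m"
  shows "search_prefix.forest C a n = search_prefix.forest C' a' n"
proof -
  interpret R: search_run n C V a S by fact
  interpret R': search_run n C' V' a' S' by fact
  have "a m = a' m \<and> C m = C' m" if "m < n" for m
  proof -
    have "V m = V' m \<and> a m = a' m \<and> S m = S' m"
      by (rule search_run_unique[OF assms(1,2) eq less_imp_le[OF that]])
    with eq[OF that] show ?thesis by blast
  qed
  then show ?thesis
    unfolding R.forest_def R'.forest_def by (intro SUP_cong refl) (simp only: lessThan_iff)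
qed

section \<open>Connected graphs with a given search tree\<close>

text \<open>\<open>F\<close> is the rule for the new nodes, so that a graph and a code can drive the
  same construction. With neither a new nor a waiting node, \<open>hd\<close> and \<open>tl\<close>
  would be applied to the empty list; the premise of \<open>search_prefix_state\<close> excludes
  this.\<close>

primrec search_state :: "(nat list \<Rightarrow> nat \<Rightarrow> nat list \<Rightarrow> nat set) \<Rightarrow> nat \<Rightarrow> nat \<Rightarrow> nat list \<times> nat \<times> nat list"
  where
  "search_state F n 0 = ([n + 1], n + 1, [])"
| "search_state F n (Suc m) =
    (case search_state F n m of (V, a, S) \<Rightarrow>
      let new = sorted_list_of_set (F V a S) in (V @ rev new, hd (new @ S), tl (new @ S)))"

definition state_visited where "state_visited F n m = fst (search_state F n m)"
definition state_active where "state_active F n m = fst (snd (search_state F n m))"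
definition state_stack where "state_stack F n m = snd (snd (search_state F n m))"
definition state_new where
  "state_new F n m = F (state_visited F n m) (state_active F n m) (state_stack F n m)"

text \<open>That the next step is legal depends on facts about the run so far. The premise may
  therefore use the locale up to the step in question.\<close>

lemma search_prefix_state:
  fixes F n
  defines "C \<equiv> state_new F n" and "V \<equiv> state_visited F n" and "a \<equiv> state_active F n"
    and "S \<equiv> state_stack F n"
  assumes step: "\<And>N. N < K \<Longrightarrow> search_prefix n N C V a S \<Longrightarrow>
    C N \<subseteq> {1..n} - set (V N) \<and> (C N \<noteq> {} \<or> S N \<noteq> [])"
  shows "N \<le> K \<Longrightarrow> search_prefix n N C V a S"
proof (induction N)
  case 0
  show ?case
    by unfold_locales
      (simp_all add: V_def a_def S_def state_visited_def state_active_def state_stack_def)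
next
  case (Suc N)
  then have prefix: "search_prefix n N C V a S" by simp
  note new = step[OF Suc_le_lessD[OF Suc.prems] prefix]
  let ?new = "sorted_list_of_set (C N)"
  have V: "V (Suc N) = V N @ rev ?new" and a: "a (Suc N) = hd (?new @ S N)"
    and S: "S (Suc N) = tl (?new @ S N)"
    unfolding C_def V_def a_def S_def state_new_def state_visited_def state_active_def
      state_stack_def by (simp_all add: Let_def split: prod.split)
  have "finite (C N)" using new finite_subset by blast
  then have "?new @ S N \<noteq> []" using new by auto
  then have aS: "a (Suc N) # S (Suc N) = ?new @ S N" unfolding a S by (rule list.collapse)
  interpret search_prefix n N C V a S by (rule prefix)
  show ?case
  proof
    fix m assume "m < Suc N"
    then consider "m < N" | "m = N" by linarith
    note mc = this
    show "V (Suc m) = V m @ rev (sorted_list_of_set (C m))"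
      using mc by cases (simp_all only: V_Suc V)
    show "a (Suc m) # S (Suc m) = sorted_list_of_set (C m) @ S m"
      using mc by cases (simp_all only: aS_Suc aS)
    show "C m \<subseteq> {1..n} - set (V m)"
      using mc by cases (use C_new new in blast)+
  qed (simp_all add: V0 a0 S0)
qed

lemma linked_closed:
  assumes "(u, v) \<in> linked G" "u \<in> W" "\<And>x y. x \<in> W \<Longrightarrow> {x, y} \<in> G \<Longrightarrow> y \<in> W"
  shows "v \<in> W"
  using assms(1) unfolding linked_def
  by (induction rule: rtrancl_induct) (use assms(2,3) in auto)

text \<open>If nothing is new and nothing waits, every visited node has been active, so the visited
  set is closed under adjacency and contains all \<open>n + 1\<close> labels by connectedness. But
  then only \<open>N + 1\<close> nodes have been visited, with \<open>N < n\<close>.\<close>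

lemma connected_search:
  assumes G: "connected_graph n G"
  shows "\<exists>C V a S. search_run n C V a S \<and> (\<forall>m<n. {w. {a m, w} \<in> G} - set (V m) = C m)"
proof -
  define F where "F = (\<lambda>V a (S :: nat list). {w. {a, w} \<in> G} - set (V :: nat list))"
  define C where "C = state_new F n"
  define V where "V = state_visited F n"
  define a where "a = state_active F n"
  define S where "S = state_stack F n"
  have C: "{w. {a m, w} \<in> G} - set (V m) = C m" for m
    unfolding C_def V_def a_def state_new_def F_def ..
  have range: "y \<in> {1..n+1}" if "{x, y} \<in> G" for x y
    using that G by (auto simp: connected_graph_def labeled_graph_def)
  have "search_prefix n n C V a S"
    unfolding C_def V_def a_def S_def
  proof (rule search_prefix_state[OF _ order.refl], fold C_def V_def a_def S_def)
    fix N assume N: "N < n" and "search_prefix n N C V a S"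
    then interpret search_prefix n N C V a S by simp
    have root: "n + 1 \<in> set (V N)" using set_V_C[of N] by simp
    have "C N \<subseteq> {1..n} - set (V N)"
    proof
      fix y assume "y \<in> C N"
      then have y: "{a N, y} \<in> G" "y \<notin> set (V N)" using C[of N] by auto
      then have "y \<noteq> n + 1" using root by auto
      with y range[OF y(1)] show "y \<in> {1..n} - set (V N)" by auto
    qed
    moreover have "C N \<noteq> {} \<or> S N \<noteq> []"
    proof (rule ccontr)
      assume "\<not> (C N \<noteq> {} \<or> S N \<noteq> [])"
      then have e: "C N = {}" "S N = []" by auto
      have closed: "y \<in> set (V N)" if x: "x \<in> set (V N)" and xy: "{x, y} \<in> G" for x y
      proof -
        obtain k where k: "k \<le> N" "x = a k" using x set_V[of N] e(2) by auto
        have y: "y \<in> set (V k) \<or> y \<in> C k" using xy C[of k] k(2) by blast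
        show ?thesis
        proof (cases "k = N")
          case True
          with y e(1) show ?thesis by auto
        next
          case False
          with k have "k < N" by simp
          with y V_mono[of "Suc k" N] C_V_Suc[of k] show ?thesis by auto
        qed
      qed
      have "{1..n+1} \<subseteq> set (V N)"
      proof
        fix v assume "v \<in> {1..n+1}"
        then have "(n + 1, v) \<in> linked G" using G unfolding connected_graph_def by simp
        then show "v \<in> set (V N)" by (rule linked_closed[OF _ root closed])
      qed
      then have "n + 1 \<le> card (set (V N))" using card_mono[of "set (V N)" "{1..n+1}"] by simp
      also have "\<dots> \<le> length (V N)" by (rule card_length)
      also have "\<dots> = Suc N" using length_V[of N] e(2) by simp
      finally show False using N by simp
    qed
    ultimately show "C N \<subseteq> {1..n} - set (V N) \<and> (C N \<noteq> {} \<or> S N \<noteq> [])" ..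
  qed
  then have "search_run n C V a S" unfolding search_run_def .
  with C show ?thesis by blast
qed

lemma connected_search_forest:
  assumes "connected_graph n G"
  obtains C V a S where "search_run n C V a S"
    and "\<And>m. m < n \<Longrightarrow> {w. {a m, w} \<in> G} - set (V m) = C m"
    and "nfs_forest n G = search_prefix.forest C a n"
proof -
  obtain C V a S where run: "search_run n C V a S"
    and C: "\<And>m. m < n \<Longrightarrow> {w. {a m, w} \<in> G} - set (V m) = C m"
    using connected_search[OF assms] by blast
  interpret search_run n C V a S by (rule run)
  have "nfs_forest n G = tree"
    unfolding nfs_forest_def using nfs_eq[of "\<lambda>v. {w. {v, w} \<in> G}"] C by simp
  with that run C show thesis by blast
qed

lemma nfs_forest_tree: "connected_graph n G \<Longrightarrow> labeled_tree n (nfs_forest n G)"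
proof (erule connected_search_forest)
  fix C V a S assume run: "search_run n C V a S" and eq: "nfs_forest n G = search_prefix.forest C a n"
  interpret search_run n C V a S by (rule run)
  show "labeled_tree n (nfs_forest n G)" unfolding eq by (rule tree)
qed

text \<open>An edge of \<open>T\<close> missed by the search of \<open>T\<close> would close a cycle
  with the path that joins its ends in the search tree, so a tree is its own search tree.\<close>

lemma labeled_tree_run:
  assumes T: "labeled_tree n T"
  obtains C V a S where "search_run n C V a S" and "T = search_prefix.forest C a n"
proof -
  have con: "connected_graph n T" using T by (simp add: labeled_tree_def)
  then obtain C V a S where run: "search_run n C V a S"
    and C: "\<And>m. m < n \<Longrightarrow> {w. {a m, w} \<in> T} - set (V m) = C m"
    by (rule connected_search_forest) blast
  interpret search_run n C V a S by (rule run)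
  have sub: "tree \<subseteq> T" unfolding forest_def using C by blast
  moreover have "T \<subseteq> tree"
  proof
    fix e assume e: "e \<in> T"
    show "e \<in> tree"
    proof (rule ccontr)
      assume ne: "e \<notin> tree"
      have "e \<subseteq> {1..n+1}" "card e = 2"
        using e con by (auto simp: connected_graph_def labeled_graph_def)
      then obtain u v where uv: "e = {u, v}" "u \<noteq> v" "u \<in> {1..n+1}" "v \<in> {1..n+1}"
        by (auto simp: card_2_iff)
      have "(u, v) \<in> linked tree" using connected uv unfolding connected_graph_def by blast
      then obtain p where p: "graph_path tree p" "hd p = u" "last p = v"
        using linked_graph_path by blast
      have "successively (\<lambda>a b. {a, b} \<in> T) p"
        by (rule successively_mono[of "\<lambda>a b. {a, b} \<in> tree"])
          (use p sub in \<open>auto simp: graph_path_def\<close>)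
      then have "graph_path T p" using p(1) by (simp add: graph_path_def)
      moreover have "3 \<le> length p"
      proof (rule ccontr)
        assume "\<not> 3 \<le> length p"
        then have "length p = 0 \<or> length p = Suc 0 \<or> length p = Suc (Suc 0)" by linarith
        then consider "p = []" | x where "p = [x]" | x y where "p = [x, y]"
          by (auto simp: length_Suc_conv)
        then show False
          by cases (use p uv ne in \<open>auto simp: graph_path_def\<close>)
      qed
      moreover have "{last p, hd p} \<in> T" using e uv p by (simp add: insert_commute)
      ultimately have "has_cycle T" by (auto simp: has_cycle_def)
      with T show False by (simp add: labeled_tree_def)
    qed
  qed
  ultimately have "T = tree" by blast
  with that run show thesis by blast
qed

lemma (in parent_tree) card_edges: "card T = n"
proof -
  have "inj_on (\<lambda>v. {v, par v}) {1..n}"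
  proof (rule inj_onI)
    fix v w assume v: "v \<in> {1..n}" and w: "w \<in> {1..n}" and eq: "{v, par v} = {w, par w}"
    show "v = w"
    proof (rule ccontr)
      assume "v \<noteq> w"
      with eq have pv: "par v = w" and pw: "par w = v" unfolding doubleton_eq_iff by metis+
      from par_rank[OF v] par_rank[OF w] show False unfolding pv pw by simp
    qed
  qed
  then show ?thesis unfolding T_eq by (simp add: card_image)
qed

lemma sum_power_card_Pow:
  fixes t :: "'a::comm_semiring_1"
  assumes "finite X"
  shows "(\<Sum>Y\<in>Pow X. t ^ card Y) = (1 + t) ^ card X"
  using prod_add[OF assms, of "\<lambda>_. t" "\<lambda>_. 1"] by (simp add: add.commute)

section \<open>Edges that leave the search unchanged\<close>

context search_run
begin

definition stack_edges :: "nat set set" where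
  "stack_edges = (\<Union>m\<in>{..n}. (\<lambda>w. {a m, w}) ` set (S m))"

text \<open>If the active node is the end of the edge that had to wait, the other end was active
  earlier; otherwise the other end is waiting now. So stack edges never offer the search a new
  node.\<close>

lemma stack_edge_visited:
  assumes "m \<le> n" "{a m, w} \<in> stack_edges"
  shows "w \<in> set (V m)"
proof -
  obtain m' w' where m': "m' \<le> n" "w' \<in> set (S m')" "{a m, w} = {a m', w'}"
    using assms(2) by (auto simp: stack_edges_def)
  from m'(3) consider "a m = a m'" "w = w'" | "a m = w'" "w = a m'"
    by (auto simp: doubleton_eq_iff)
  then show ?thesis
  proof cases
    case 1
    then have "m = m'" using assms(1) m'(1) by (simp add: a_eq_iff)
    with 1 m' show ?thesis by (simp add: set_V)
  next
    case 2
    with m' have "m' \<le> m" using a_notin_S[of m m'] by (metis nat_le_linear)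
    with 2 show ?thesis using assms(1) by (simp add: set_V)
  qed
qed

lemma tree_edge_new:
  assumes m: "m \<le> n" and e: "{a m, w} \<in> tree" and w: "w \<notin> set (V m)"
  shows "m < n \<and> w \<in> C m"
  using e unfolding edge_iff
proof
  assume "a m \<in> {1..n} \<and> w = tree_par (a m)"
  then have am: "a m \<in> {1..n}" and par: "w = tree_par (a m)" by auto
  have "w \<in> a ` {..n}" using par_in[OF am] par a_image by simp
  then obtain k where k: "k \<le> n" "w = a k" by auto
  have "k < m" using par_rank[OF am] unfolding par[symmetric] k(2) by (simp add: rank_a k m)
  with k m have "w \<in> set (V m)" by (simp add: set_V)
  with w show ?thesis ..
next
  assume *: "w \<in> {1..n} \<and> a m = tree_par w"
  then have "w \<in> set (V n)" using set_V_end by simp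
  with w have "m \<noteq> n" by auto
  with m have "m < n" by simp
  moreover have "w \<in> children n tree (a m)" using * unfolding children_iff .
  ultimately show ?thesis by (simp add: children_a)
qed

lemma stack_edges_labeled: "labeled_graph n stack_edges"
  unfolding labeled_graph_def
proof
  fix e assume "e \<in> stack_edges"
  then obtain m w where m: "m \<le> n" "w \<in> set (S m)" "e = {a m, w}" by (auto simp: stack_edges_def)
  have "a m \<in> {1..n+1}" using a_image m(1) by blast
  moreover have "w \<in> {1..n+1}" using set_V[of m] V_subset[of m] m by blast
  moreover have "a m \<noteq> w" using a_notin_S[of m m] m by auto
  ultimately show "e \<in> {e. e \<subseteq> {1..n+1} \<and> card e = 2}" using m(3) by auto
qed

lemma connected_nfs_iff:
  "connected_graph n G \<and> nfs_forest n G = tree \<longleftrightarrow> tree \<subseteq> G \<and> G \<subseteq> tree \<union> stack_edges"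
proof
  assume G: "connected_graph n G \<and> nfs_forest n G = tree"
  then obtain C' V' a' S' where run': "search_run n C' V' a' S'"
    and C': "\<And>m. m < n \<Longrightarrow> {w. {a' m, w} \<in> G} - set (V' m) = C' m"
    and eq: "nfs_forest n G = search_prefix.forest C' a' n"
    using connected_search_forest by blast
  interpret R': search_run n C' V' a' S' by (rule run')
  \<comment> \<open>Both runs find the children of the active node in the same tree, so they
    coincide.\<close>
  have same: "C m = C' m" if "m < n" "a m = a' m" for m
    using children_a[OF that(1)] R'.children_a[OF that(1)] G eq that(2) by simp
  have Va: "V m = V' m \<and> a m = a' m \<and> S m = S' m" if "m \<le> n" for m
    by (rule search_run_unique[OF _ run' same that]) unfold_locales
  have adj: "{w. {a m, w} \<in> G} - set (V m) = C m" if "m < n" for m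
    using C'[OF that] Va[OF less_imp_le[OF that]] same[OF that] by simp
  have "tree \<subseteq> G" unfolding forest_def using adj by blast
  moreover have "e \<in> tree \<union> stack_edges" if e: "e \<in> G" for e
  proof -
    have "e \<subseteq> {1..n+1}" "card e = 2"
      using e G by (auto simp: connected_graph_def labeled_graph_def)
    then obtain u v where uv: "e = {u, v}" "u \<noteq> v" "u \<in> {1..n+1}" "v \<in> {1..n+1}"
      by (auto simp: card_2_iff)
    then have "u \<in> a ` {..n}" "v \<in> a ` {..n}" using a_image by simp_all
    then obtain i k where ik: "i \<le> n" "k \<le> n" "u = a i" "v = a k" by auto
    \<comment> \<open>When the first end becomes active, the second is either visited, and then
      waiting since it is not yet active, or new.\<close>
    have main: "{a i, a k} \<in> tree \<union> stack_edges" if "i < k" "k \<le> n" "{a i, a k} \<in> G" for i k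
    proof (cases "a k \<in> set (V i)")
      case True
      have "a k \<notin> a ` {..i}"
      proof
        assume "a k \<in> a ` {..i}"
        then obtain l where "l \<le> i" "a k = a l" by auto
        with that show False using a_eq_iff[of k l] by simp
      qed
      with True set_V[of i] that have "a k \<in> set (S i)" by simp
      then show ?thesis using that unfolding stack_edges_def by auto
    next
      case False
      with adj[of i] that have "a k \<in> C i" by auto
      then show ?thesis using that unfolding forest_def by auto
    qed
    have "i \<noteq> k" using ik uv by auto
    then consider "i < k" | "k < i" by linarith
    then show ?thesis
    proof cases
      case 1
      then show ?thesis using main[of i k] ik uv e by simp
    next
      case 2
      then show ?thesis using main[of k i] ik uv e by (simp add: insert_commute)
    qed
  qed
  ultimately show "tree \<subseteq> G \<and> G \<subseteq> tree \<union> stack_edges" by blast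
next
  assume G: "tree \<subseteq> G \<and> G \<subseteq> tree \<union> stack_edges"
  have adj: "{w. {a m, w} \<in> G} - set (V m) = C m" if m: "m < n" for m
  proof
    show "{w. {a m, w} \<in> G} - set (V m) \<subseteq> C m"
    proof
      fix w assume "w \<in> {w. {a m, w} \<in> G} - set (V m)"
      then have w: "{a m, w} \<in> tree \<union> stack_edges" "w \<notin> set (V m)" using G by auto
      with m stack_edge_visited[of m w] have "{a m, w} \<in> tree" by auto
      with tree_edge_new[of m w] w m show "w \<in> C m" by simp
    qed
    have "{a m, w} \<in> tree" if "w \<in> C m" for w using that m unfolding forest_def by blast
    then show "C m \<subseteq> {w. {a m, w} \<in> G} - set (V m)" using C_new[OF m] G by blast
  qed
  have "nfs_forest n G = tree"
    unfolding nfs_forest_def using nfs_eq[of "\<lambda>v. {w. {v, w} \<in> G}"] adj by simp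
  moreover have "labeled_graph n G"
    using G labeled stack_edges_labeled unfolding labeled_graph_def by blast
  then have "connected_graph n G"
    using connected linked_mono[of tree G] G unfolding connected_graph_def by blast
  ultimately show "connected_graph n G \<and> nfs_forest n G = tree" by simp
qed

lemma stack_edges_disjoint: "tree \<inter> stack_edges = {}"
proof -
  have "{a m, w} \<notin> stack_edges" if "m < n" "w \<in> C m" for m w
    using stack_edge_visited[of m w] C_new[OF that(1)] that by auto
  then show ?thesis unfolding forest_def by auto
qed

lemma finite_stack_edges: "finite stack_edges"
  by (simp add: stack_edges_def)

lemma card_stack_edges: "card stack_edges = cane_number n tree"
proof -
  have "card stack_edges = (\<Sum>m\<in>{..n}. card ((\<lambda>w. {a m, w}) ` set (S m)))"
    unfolding stack_edges_def
  proof (rule card_UN_disjoint, simp, simp, safe)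
    fix i k w w' assume *: "i \<le> n" "k \<le> n" "i \<noteq> k" "w \<in> set (S i)" "w' \<in> set (S k)"
      and "{a i, w} = {a k, w'}"
    \<comment> \<open>An edge arising at two times would make each end wait while the other is
      active, so each would be activated after the other.\<close>
    then have "a i = w'" "w = a k" using a_eq_iff[of i k] by (auto simp: doubleton_eq_iff)
    with * have "\<not> i \<le> k" "\<not> k \<le> i" using a_notin_S[of i k] a_notin_S[of k i] by auto
    then show "{a i, w} \<in> {}" by linarith
  qed
  also have "\<dots> = (\<Sum>m\<in>{..n}. cane (a m))"
  proof (rule sum.cong[OF refl])
    fix m assume m: "m \<in> {..n}"
    have "distinct (S m)" using distinct_aS[of m] m by simp
    moreover have "inj_on (\<lambda>w. {a m, w}) (set (S m))" by (auto simp: inj_on_def doubleton_eq_iff)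
    ultimately show "card ((\<lambda>w. {a m, w}) ` set (S m)) = cane (a m)"
      using cane_a[of m] m by (simp add: card_image distinct_card)
  qed
  also have "\<dots> = sum cane (a ` {..n})"
    by (rule sum.reindex_cong[symmetric, where l = a]) (auto simp: inj_on_def a_eq_iff)
  finally show ?thesis unfolding a_image cane_number_sum .
qed

lemma sum_connected_nfs:
  fixes t :: real
  shows "(\<Sum>G | connected_graph n G \<and> nfs_forest n G = tree. t ^ card G) =
    t ^ n * (1 + t) ^ cane_number n tree"
proof -
  have fin: "finite tree" using T_eq by simp
  have set_eq: "{G. connected_graph n G \<and> nfs_forest n G = tree} = (\<union>) tree ` Pow stack_edges"
    unfolding connected_nfs_iff
  proof (intro equalityI subsetI)
    fix G assume "G \<in> {G. tree \<subseteq> G \<and> G \<subseteq> tree \<union> stack_edges}"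
    then have "G = tree \<union> (G - tree)" "G - tree \<in> Pow stack_edges" by auto
    then show "G \<in> (\<union>) tree ` Pow stack_edges" by (rule image_eqI)
  qed auto
  have "inj_on ((\<union>) tree) (Pow stack_edges)"
    using stack_edges_disjoint by (intro inj_onI) blast
  then have "(\<Sum>G | connected_graph n G \<and> nfs_forest n G = tree. t ^ card G) =
      (\<Sum>Y\<in>Pow stack_edges. t ^ card (tree \<union> Y))"
    unfolding set_eq by (simp add: sum.reindex)
  also have "\<dots> = (\<Sum>Y\<in>Pow stack_edges. t ^ n * t ^ card Y)"
  proof (rule sum.cong[OF refl])
    fix Y assume "Y \<in> Pow stack_edges"
    then have "finite Y" "tree \<inter> Y = {}"
      using finite_stack_edges finite_subset stack_edges_disjoint by blast+
    then show "t ^ card (tree \<union> Y) = t ^ n * t ^ card Y"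
      using fin by (simp add: card_Un_disjoint card_edges power_add)
  qed
  finally show ?thesis
    by (simp add: sum_distrib_left[symmetric] sum_power_card_Pow finite_stack_edges card_stack_edges)
qed

end

lemma sum_connected_nfs_tree:
  fixes t :: real
  assumes "labeled_tree n T"
  shows "(\<Sum>G | connected_graph n G \<and> nfs_forest n G = T. t ^ card G) =
    t ^ n * (1 + t) ^ cane_number n T"
proof -
  obtain C V a S where run: "search_run n C V a S" and T: "T = search_prefix.forest C a n"
    using assms by (rule labeled_tree_run)
  interpret search_run n C V a S by (rule run)
  show ?thesis unfolding T by (rule sum_connected_nfs)
qed

section \<open>Trees and their codes\<close>

lemma (in search_prefix) search_prefix_le:
  assumes "M \<le> N"
  shows "search_prefix n M C V a S"
proof
  fix m assume "m < M"
  then have m: "m < N" using assms by simp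
  show "V (Suc m) = V m @ rev (sorted_list_of_set (C m))" by (rule V_Suc[OF m])
  show "a (Suc m) # S (Suc m) = sorted_list_of_set (C m) @ S m" by (rule aS_Suc[OF m])
  show "C m \<subseteq> {1..n} - set (V m)" by (rule C_new[OF m])
qed (rule V0 a0 S0)+

text \<open>Along a run of rising heights, \<open>code\<close> makes the labels decrease. Listing
  the set \<open>batch\<close> in decreasing order therefore returns a segment of \<open>L\<close>
  in its own order, and a decoded search visits the labels as \<open>L\<close> prescribes.\<close>

lemma batch_segment:
  assumes L: "distinct L" "p \<le> length L"
    and code: "\<And>i. Suc i < length L \<Longrightarrow> c (L ! Suc i) = Suc (c (L ! i)) \<Longrightarrow> L ! Suc i < L ! i"
  obtains r where "p + r \<le> length L"
    "rev (sorted_list_of_set (batch L c p h)) = take r (drop p L)"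
    "\<And>i. i < r \<Longrightarrow> c (L ! (p + i)) = h + i"
    "p + r < length L \<Longrightarrow> c (L ! (p + r)) \<noteq> h + r"
proof -
  define Q where "Q i \<longleftrightarrow> p + i < length L \<and> c (L ! (p + i)) = h + i" for i
  define r where "r = (LEAST i. \<not> Q i)"
  have "\<not> Q (length L)" by (simp add: Q_def)
  then have nQ: "\<not> Q r" unfolding r_def by (rule LeastI)
  have Q: "Q i" if "i < r" for i using that not_less_Least unfolding r_def by blast
  have le: "p + r \<le> length L"
  proof (cases r)
    case 0
    then show ?thesis using L by simp
  next
    case (Suc i)
    then show ?thesis using Q[of i] by (simp add: Q_def)
  qed
  let ?seg = "take r (drop p L)"
  have len: "length ?seg = r" using le by simp
  have nth: "?seg ! i = L ! (p + i)" if "i < r" for i using that le by simp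
  have "batch L c p h = {L ! (p + i) | i. \<forall>k\<le>i. Q k}"
  proof -
    have "p + i < length L \<and> (\<forall>k\<le>i. c (L ! (p + k)) = h + k) \<longleftrightarrow> (\<forall>k\<le>i. Q k)" for i
      unfolding Q_def by fastforce
    then show ?thesis unfolding batch_def by simp
  qed
  also have "(\<forall>k\<le>i. Q k) \<longleftrightarrow> i < r" for i
  proof
    assume "\<forall>k\<le>i. Q k"
    then show "i < r" using nQ by (meson not_le)
  next
    assume "i < r"
    then show "\<forall>k\<le>i. Q k" using Q le_less_trans by blast
  qed
  then have "{L ! (p + i) | i. \<forall>k\<le>i. Q k} = {L ! (p + i) | i. i < r}" by simp
  also have "\<dots> = {?seg ! i | i. i < length ?seg}"
    unfolding len using nth by (intro Collect_cong) metis
  also have "\<dots> = set ?seg" unfolding set_conv_nth ..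
  finally have b: "batch L c p h = set (rev ?seg)" by simp
  have dec: "?seg ! Suc i < ?seg ! i" if "Suc i < r" for i
  proof -
    have "c (L ! Suc (p + i)) = Suc (c (L ! (p + i)))" "Suc (p + i) < length L"
      using Q[of i] Q[of "Suc i"] that by (auto simp: Q_def)
    then show ?thesis using code[of "p + i"] nth[of i] nth[of "Suc i"] that by simp
  qed
  have "sorted_wrt (>) ?seg"
    by (rule sorted_wrt_iff_nth_Suc_transp[THEN iffD2]) (use dec len in \<open>auto simp: transp_def\<close>)
  then have "sorted_wrt (<) (rev ?seg)" by (simp add: sorted_wrt_rev)
  then have "sorted_list_of_set (set (rev ?seg)) = rev ?seg"
    by (intro sorted_list_of_set.idem_if_sorted_distinct)
      (simp_all add: strict_sorted_iff)
  then have "rev (sorted_list_of_set (batch L c p h)) = ?seg" unfolding b by simp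
  moreover have "c (L ! (p + i)) = h + i" if "i < r" for i using Q[OF that] by (simp add: Q_def)
  moreover have "c (L ! (p + r)) \<noteq> h + r" if "p + r < length L" using nQ that by (simp add: Q_def)
  ultimately show thesis using that le by blast
qed

lemma rev_segment_split:
  assumes "rev (take r (drop p L)) = ys @ x # zs" "p + r \<le> length L"
  shows "length zs < r \<and> x = L ! (p + length zs)"
proof -
  have "take r (drop p L) = rev zs @ x # rev ys" using arg_cong[OF assms(1), of rev] by simp
  then have "length zs < length (take r (drop p L))" "take r (drop p L) ! length zs = x"
    by (simp_all add: nth_append)
  then show ?thesis using assms(2) by simp
qed

text \<open>
  A list of labels with heights is decoded by letting the next new nodes be those that the heights
  place on top of the current stack.
\<close>

lemma code_search_run:
  assumes L: "distinct L" "set L = {1..n+1}" "L ! 0 = n + 1" and c0: "c (n + 1) = 0"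
    and code: "successively (code_rel n c) L"
  obtains C V a S where "search_run n C V a S" "V n = L" "\<And>m. m \<le> n \<Longrightarrow> length (S m) = c (a m)"
proof -
  define F where "F = (\<lambda>V (a :: nat) (S :: nat list). batch L c (length (V :: nat list)) (length S))"
  define C where "C = state_new F n"
  define V where "V = state_visited F n"
  define a where "a = state_active F n"
  define S where "S = state_stack F n"
  have C: "C m = batch L c (length (V m)) (length (S m))" for m
    unfolding C_def V_def S_def state_new_def F_def ..
  have lenL: "length L = n + 1" using distinct_card[OF L(1)] L(2) by simp
  have step: "code_rel n c (L ! i) (L ! Suc i)" if "Suc i < length L" for i
    using successively_nthD[OF code that] .
  have dec: "L ! Suc i < L ! i"
    if "Suc i < length L" "c (L ! Suc i) = Suc (c (L ! i))" for i
    using step[OF that(1)] that(2) by (simp add: code_rel_def)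
  \<comment> \<open>The search has read an initial segment of \<open>L\<close>, and the nodes of
    \<open>a N # S N\<close> have as heights the numbers of nodes below them. The bound on the
    height of the next label keeps the search from getting stuck.\<close>
  define I where "I N \<longleftrightarrow> V N = take (length (V N)) L \<and> length (V N) \<le> n + 1
      \<and> (length (V N) \<le> n \<longrightarrow> c (L ! length (V N)) \<le> length (S N))
      \<and> (\<forall>ys x xs. a N # S N = ys @ x # xs \<longrightarrow> c x = length xs)" for N
  have new_ok: "C N \<subseteq> {1..n} - set (V N) \<and> (C N \<noteq> {} \<or> S N \<noteq> [])"
    if N: "N < n" and pre: "search_prefix n N C V a S" and I: "I N" for N
  proof -
    interpret search_prefix n N C V a S by (rule pre)
    have V: "V N = take (length (V N)) L" using I by (simp add: I_def)
    have root: "n + 1 \<in> set (V N)" using set_V_C[of N] by simp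
    have "C N \<subseteq> {1..n} - set (V N)"
    proof
      fix v assume "v \<in> C N"
      then obtain i where i: "v = L ! (length (V N) + i)" "length (V N) + i < length L"
        unfolding C batch_def by blast
      have "v \<notin> set (V N)"
      proof
        assume "v \<in> set (V N)"
        then have "v \<in> set (take (length (V N)) L)" using V by simp
        then obtain k where "k < length (V N)" "v = L ! k" by (auto simp: in_set_conv_nth)
        then show False using i L(1) nth_eq_iff_index_eq[of L "length (V N) + i" k] by simp
      qed
      moreover have "v \<in> {1..n+1}" using i L(2) nth_mem by blast
      moreover have "v \<noteq> n + 1" using root \<open>v \<notin> set (V N)\<close> by auto
      ultimately show "v \<in> {1..n} - set (V N)" by auto
    qed
    moreover have "C N \<noteq> {}" if S: "S N = []"
    proof -
      \<comment> \<open>On an empty stack the next label must have height 0, so it starts a nonempty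
        batch.\<close>
      have p: "length (V N) \<le> n" using length_V[of N] S N by simp
      then have "c (L ! length (V N)) = 0" using I S by (simp add: I_def)
      then have "L ! (length (V N) + 0) \<in> C N"
        unfolding C batch_def S using p lenL by (intro CollectI exI[of _ 0]) simp
      then show ?thesis by blast
    qed
    ultimately show ?thesis by blast
  qed
  have I_step: "I (Suc N)"
    if N: "N < n" and pre: "search_prefix n (Suc N) C V a S" and I: "I N" for N
  proof -
    interpret search_prefix n "Suc N" C V a S by (rule pre)
    let ?p = "length (V N)" and ?h = "length (S N)"
    have p: "?p \<le> length L" using I lenL by (simp add: I_def)
    obtain r where r: "?p + r \<le> length L"
      "rev (sorted_list_of_set (batch L c ?p ?h)) = take r (drop ?p L)"
      "\<And>i. i < r \<Longrightarrow> c (L ! (?p + i)) = ?h + i"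
      "?p + r < length L \<Longrightarrow> c (L ! (?p + r)) \<noteq> ?h + r"
    proof (rule batch_segment[of L ?p c ?h, OF L(1) p])
      show "L ! Suc i < L ! i" if "Suc i < length L" "c (L ! Suc i) = Suc (c (L ! i))" for i
        using dec that .
    qed (rule that)
    have new: "sorted_list_of_set (C N) = rev (take r (drop ?p L))"
      unfolding C r(2)[symmetric] by simp
    have aS: "a (Suc N) # S (Suc N) = rev (take r (drop ?p L)) @ S N"
      using aS_Suc[of N] unfolding new by simp
    have VS: "V (Suc N) = V N @ take r (drop ?p L)"
      using V_Suc[of N] unfolding new by simp
    have lenV: "length (V (Suc N)) = ?p + r" using r(1) unfolding VS by simp
    have lenS: "Suc (length (S (Suc N))) = r + ?h"
      using arg_cong[OF aS, of length] r(1) by simp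
    have "V N = take ?p L" using I by (simp add: I_def)
    then have "V (Suc N) = take ?p L @ take r (drop ?p L)" unfolding VS by (rule arg_cong)
    then have 1: "V (Suc N) = take (length (V (Suc N))) L" unfolding lenV take_add .
    \<comment> \<open>The next height is at most \<open>?h + r\<close>, by the code condition or,
      for \<open>r = 0\<close>, by the invariant. The end of the run excludes equality, and one less
      is the new stack height.\<close>
    have 3: "c (L ! (?p + r)) \<le> length (S (Suc N))" if "?p + r \<le> n"
    proof (cases r)
      case 0
      then show ?thesis using r(4) that lenL lenS I unfolding I_def by auto
    next
      case (Suc i)
      then have lt: "Suc (?p + i) < length L" using that lenL by simp
      have "c (L ! (?p + i)) = ?h + i" using r(3)[of i] Suc by simp
      with step[OF lt] have "c (L ! (?p + r)) \<le> ?h + r" unfolding Suc code_rel_def by auto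
      then show ?thesis using r(4) that lenL lenS by simp
    qed
    have I4: "c x = length xs" if "a N # S N = ys @ x # xs" for ys x xs
      using I that unfolding I_def by simp
    have 4: "c x = length xs" if eq: "a (Suc N) # S (Suc N) = ys @ x # xs" for ys x xs
    proof -
      have "rev (take r (drop ?p L)) @ S N = ys @ x # xs" using eq unfolding aS .
      then obtain us where "rev (take r (drop ?p L)) = ys @ us \<and> us @ S N = x # xs \<or>
          rev (take r (drop ?p L)) @ us = ys \<and> S N = us @ x # xs"
        unfolding append_eq_append_conv2 by blast
      then consider us where "S N = us @ x # xs"
        | zs where "rev (take r (drop ?p L)) = ys @ x # zs" "xs = zs @ S N"
        by (cases us) auto
      then show ?thesis
      proof cases
        case 1
        then have "a N # S N = (a N # us) @ x # xs" by simp
        with I4 show ?thesis .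
      next
        case 2
        with rev_segment_split[OF 2(1) r(1)] r(3)[of "length zs"] show ?thesis by simp
      qed
    qed
    have "length (V (Suc N)) \<le> n + 1" using r(1) lenL unfolding lenV by simp
    moreover have "length (V (Suc N)) \<le> n \<longrightarrow> c (L ! length (V (Suc N))) \<le> length (S (Suc N))"
      using 3 unfolding lenV by simp
    ultimately show "I (Suc N)" unfolding I_def using 1 4 by simp
  qed
  have I0: "I 0"
  proof -
    have e: "V 0 = [n + 1]" "a 0 = n + 1" "S 0 = []"
      by (simp_all add: V_def a_def S_def state_visited_def state_active_def state_stack_def)
    have "take 1 L = [n + 1]" using L(3) lenL by (cases L) simp_all
    moreover have "c (L ! 1) \<le> 0" if "1 \<le> n"
      using step[of 0] that lenL L(3) c0 by (simp add: code_rel_def)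
    moreover have "c x = length xs" if "[n + 1] = ys @ x # xs" for ys x xs
      using that c0 by (cases ys) auto
    ultimately show ?thesis unfolding I_def e by simp
  qed
  have pre: "search_prefix n N C V a S \<and> I N" if "N \<le> n" for N
    using that
  proof (induction N)
    case 0
    then show ?case using I0 search_prefix_state[of 0 n F 0] unfolding C_def V_def a_def S_def by simp
  next
    case (Suc N)
    have "search_prefix n (Suc N) C V a S"
      unfolding C_def V_def a_def S_def
    proof (rule search_prefix_state[OF _ order.refl], fold C_def V_def a_def S_def)
      fix M assume M: "M < Suc N" and preM: "search_prefix n M C V a S"
      have pN: "search_prefix n N C V a S" "I N" using Suc by simp_all
      \<comment> \<open>\<open>search_prefix_state\<close> asks for all steps from the start again,
        so the invariant at the earlier \<open>M\<close> is rebuilt from \<open>I 0\<close>.\<close>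
      have "I M"
        using M
      proof (induction M)
        case 0
        show ?case by (rule I0)
      next
        case (Suc M)
        interpret search_prefix n N C V a S by (rule pN)
        have "search_prefix n (Suc M) C V a S" using Suc.prems by (intro search_prefix_le) simp
        then show ?case using I_step[of M] Suc \<open>Suc N \<le> n\<close> by simp
      qed
      then show "C M \<subseteq> {1..n} - set (V M) \<and> (C M \<noteq> {} \<or> S M \<noteq> [])"
        using new_ok[OF _ preM] M \<open>Suc N \<le> n\<close> by simp
    qed
    with I_step[of N] Suc show ?case by simp
  qed
  then have run: "search_run n C V a S" unfolding search_run_def by simp
  then interpret search_run n C V a S .
  have "V n = L" using pre[of n] length_V_end lenL by (simp add: I_def)
  moreover have "length (S m) = c (a m)" if "m \<le> n" for m
  proof -
    have "a m # S m = [] @ a m # S m" by simp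
    moreover have "\<forall>ys x xs. a m # S m = ys @ x # xs \<longrightarrow> c x = length xs"
      using pre[OF that] by (simp add: I_def)
    ultimately show ?thesis by metis
  qed
  ultimately show thesis using that run by blast
qed

section \<open>Codes in terms of positions and numbers of cane paths\<close>

lemma length_takeWhile_nth:
  assumes "distinct L" "i < length L"
  shows "length (takeWhile (\<lambda>v. v \<noteq> L ! i) L) = i"
proof -
  have "takeWhile (\<lambda>v. v \<noteq> L ! i) L = take i L"
    using assms by (intro takeWhile_eq_take_P_nth) (auto simp: nth_eq_iff_index_eq)
  then show ?thesis using assms by simp
qed

lemma (in search_run) nfs_position_nth: "i \<le> n \<Longrightarrow> nfs_position n tree (V n ! i) = i"
  unfolding nfs_position_def nfs_children
  using length_takeWhile_nth[OF distinct_V[OF order.refl], of i] length_V_end by simp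

lemma labeled_tree_code:
  assumes "labeled_tree n T"
  obtains C V a S where "search_run n C V a S" "T = search_prefix.forest C a n"
    "distinct (V n)" "set (V n) = {1..n+1}" "length (V n) = n + 1" "V n ! 0 = n + 1"
    "\<forall>i\<le>n. nfs_position n T (V n ! i) = i"
    "successively (code_rel n (canes_from n T)) (V n)" "canes_from n T (n + 1) = 0"
proof -
  obtain C V a S where run: "search_run n C V a S" and T: "T = search_prefix.forest C a n"
    using assms by (rule labeled_tree_run)
  interpret search_run n C V a S by (rule run)
  obtain us where "V n = V 0 @ us" using V_prefix[of 0 n] by auto
  then have "V n ! 0 = n + 1" by (simp add: V0)
  then show thesis
    using that[OF run T] distinct_V[of n] set_V_end length_V_end nfs_position_nth code_V[of n]
      canes_from_root unfolding T by blast
qed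

lemma nth_eq_position:
  assumes "length L = n + 1" "set L = {1..n+1}" "\<forall>i\<le>n. P (L ! i) = i" "k \<in> {1..n+1}"
  shows "L ! P k = k" "P k \<le> n"
proof -
  have "k \<in> set L" using assms by simp
  then obtain i where "i < length L" "k = L ! i" unfolding in_set_conv_nth by blast
  then show "L ! P k = k" "P k \<le> n" using assms(1,3) by simp_all
qed

lemma nfs_position_bij:
  assumes T: "labeled_tree n T"
  shows "bij_betw (nfs_position n T) {1..n} {1..n}"
proof -
  obtain C V a S where *: "search_run n C V a S" "T = search_prefix.forest C a n"
    "distinct (V n)" "set (V n) = {1..n+1}" "length (V n) = n + 1" "V n ! 0 = n + 1"
    "\<forall>i\<le>n. nfs_position n T (V n ! i) = i"
    "successively (code_rel n (canes_from n T)) (V n)" "canes_from n T (n + 1) = 0"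
    by (rule labeled_tree_code[OF T])
  note pos = nth_eq_position[OF *(5,4,7)]
  show ?thesis
  proof (rule bij_betwI[where g = "\<lambda>i. V n ! i"])
    show "nfs_position n T \<in> {1..n} \<rightarrow> {1..n}"
    proof
      fix k assume k: "k \<in> {1..n}"
      have "nfs_position n T k \<noteq> 0"
      proof
        assume "nfs_position n T k = 0"
        with pos(1)[of k] *(6) k show False by simp
      qed
      then show "nfs_position n T k \<in> {1..n}" using pos(2)[of k] k by simp
    qed
    show "(\<lambda>i. V n ! i) \<in> {1..n} \<rightarrow> {1..n}"
    proof
      fix i assume i: "i \<in> {1..n}"
      then have "V n ! i \<in> {1..n+1}" using *(4,5) nth_mem[of i "V n"] by simp
      moreover have "V n ! i \<noteq> n + 1"
        using i *(3,5,6) nth_eq_iff_index_eq[of "V n" i 0] by auto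
      ultimately show "V n ! i \<in> {1..n}" by auto
    qed
    show "V n ! nfs_position n T k = k" if "k \<in> {1..n}" for k using pos(1)[of k] that by simp
    show "nfs_position n T (V n ! i) = i" if "i \<in> {1..n}" for i using *(7) that by simp
  qed
qed

lemma canes_from_first:
  assumes T: "labeled_tree n T" and k: "k \<in> {1..n}" "nfs_position n T k = 1"
  shows "canes_from n T k = 0"
proof -
  obtain C V a S where *: "search_run n C V a S" "T = search_prefix.forest C a n"
    "distinct (V n)" "set (V n) = {1..n+1}" "length (V n) = n + 1" "V n ! 0 = n + 1"
    "\<forall>i\<le>n. nfs_position n T (V n ! i) = i"
    "successively (code_rel n (canes_from n T)) (V n)" "canes_from n T (n + 1) = 0"
    by (rule labeled_tree_code[OF T])
  have "V n ! 1 = k" using nth_eq_position(1)[OF *(5,4,7), of k] k by simp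
  then show ?thesis
    using successively_nthD[OF *(8), of 0] *(5,6,9) k by (simp add: code_rel_def)
qed

lemma canes_from_step:
  assumes T: "labeled_tree n T" and k: "k \<in> {1..n}" "k' \<in> {1..n}"
    and pos: "nfs_position n T k' = Suc (nfs_position n T k)"
  shows "canes_from n T k' \<le> canes_from n T k \<or> canes_from n T k' = Suc (canes_from n T k) \<and> k' < k"
proof -
  obtain C V a S where *: "search_run n C V a S" "T = search_prefix.forest C a n"
    "distinct (V n)" "set (V n) = {1..n+1}" "length (V n) = n + 1" "V n ! 0 = n + 1"
    "\<forall>i\<le>n. nfs_position n T (V n ! i) = i"
    "successively (code_rel n (canes_from n T)) (V n)" "canes_from n T (n + 1) = 0"
    by (rule labeled_tree_code[OF T])
  note nth = nth_eq_position[OF *(5,4,7)]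
  have "Suc (nfs_position n T k) < length (V n)" using nth(2)[of k'] k *(5) pos by simp
  from successively_nthD[OF *(8) this] show ?thesis
    using nth(1)[of k] nth(1)[of k'] k unfolding pos code_rel_def by auto
qed

text \<open>Positions give the search order; by \<open>C_batch\<close> the numbers of cane paths
  then give the new nodes at every step, and the two runs coincide.\<close>

lemma labeled_tree_eqI:
  assumes T: "labeled_tree n T" and T': "labeled_tree n T'"
    and pos: "\<And>k. k \<in> {1..n} \<Longrightarrow> nfs_position n T k = nfs_position n T' k"
    and canes: "\<And>k. k \<in> {1..n} \<Longrightarrow> canes_from n T k = canes_from n T' k"
  shows "T = T'"
proof -
  obtain C V a S where *: "search_run n C V a S" "T = search_prefix.forest C a n"
    "distinct (V n)" "set (V n) = {1..n+1}" "length (V n) = n + 1" "V n ! 0 = n + 1"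
    "\<forall>i\<le>n. nfs_position n T (V n ! i) = i"
    "successively (code_rel n (canes_from n T)) (V n)" "canes_from n T (n + 1) = 0"
    by (rule labeled_tree_code[OF T])
  obtain C' V' a' S' where B: "search_run n C' V' a' S'" "T' = search_prefix.forest C' a' n"
    "distinct (V' n)" "set (V' n) = {1..n+1}" "length (V' n) = n + 1" "V' n ! 0 = n + 1"
    "\<forall>i\<le>n. nfs_position n T' (V' n ! i) = i"
    "successively (code_rel n (canes_from n T')) (V' n)" "canes_from n T' (n + 1) = 0"
    by (rule labeled_tree_code[OF T'])
  interpret R: search_run n C V a S by (rule *)
  interpret R': search_run n C' V' a' S' by (rule B)
  have V: "V n = V' n"
  proof (rule nth_equalityI)
    fix i assume i: "i < length (V n)"
    show "V n ! i = V' n ! i"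
    proof (cases "i = 0")
      case False
      have "V n ! i \<in> {1..n+1}" using *(4) nth_mem[OF i] by simp
      moreover have "V n ! i \<noteq> n + 1"
        using i False *(3,5,6) nth_eq_iff_index_eq[of "V n" i 0] by auto
      ultimately have v: "V n ! i \<in> {1..n}" by auto
      have "nfs_position n T' (V n ! i) = i" using pos[OF v] *(7) i *(5) by simp
      then show ?thesis
        using nth_eq_position(1)[OF B(5,4,7), of "V n ! i"] \<open>V n ! i \<in> {1..n+1}\<close> by simp
    qed (simp add: * B)
  qed (simp add: * B)
  have c: "canes_from n T v = canes_from n T' v" if "v \<in> set (V' n)" for v
  proof (cases "v = n + 1")
    case True
    then show ?thesis using *(9) B(9) by simp
  next
    case False
    with that B(4) show ?thesis by (intro canes) auto
  qed
  have "C m = C' m" if "m < n" "V m = V' m" "S m = S' m" for m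
  proof -
    have "C m = batch (V n) (canes_from n T) (length (V m)) (length (S m))"
      unfolding *(2) by (rule R.C_batch[OF that(1)])
    also have "\<dots> = batch (V' n) (canes_from n T') (length (V' m)) (length (S' m))"
      unfolding V that(2,3) by (rule batch_cong) (rule c)
    also have "\<dots> = C' m"
      unfolding B(2) by (rule R'.C_batch[OF that(1), symmetric])
    finally show ?thesis .
  qed
  then show ?thesis
    unfolding *(2) B(2) by (intro search_run_unique_forest[OF *(1) B(1)])
qed

text \<open>The inverse of \<open>P\<close>, headed by the root, is the list to be decoded. The
  hypothesis \<open>first\<close> is the code condition directly after the root, where no rise is
  allowed.\<close>

lemma labeled_tree_of_code:
  assumes P: "bij_betw P {1..n} {1..n}"
    and first: "\<And>k. k \<in> {1..n} \<Longrightarrow> P k = 1 \<Longrightarrow> c k = 0"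
    and step: "\<And>k k'. k \<in> {1..n} \<Longrightarrow> k' \<in> {1..n} \<Longrightarrow> P k' = Suc (P k) \<Longrightarrow>
      c k' \<le> c k \<or> c k' = Suc (c k) \<and> k' < k"
  obtains T where "labeled_tree n T" "\<And>k. k \<in> {1..n} \<Longrightarrow> nfs_position n T k = P k"
    "\<And>k. k \<in> {1..n} \<Longrightarrow> canes_from n T k = c k"
proof -
  define l where "l i = (if i = 0 then n + 1 else inv_into {1..n} P i)" for i
  define c' where "c' v = (if v = n + 1 then 0 else c v)" for v
  define L where "L = map l [0..<Suc n]"
  have lenL: "length L = n + 1" by (simp add: L_def)
  have nth: "L ! i = l i" if "i \<le> n" for i
    using that unfolding L_def by (simp del: upt_Suc)
  have l_in: "l i \<in> {1..n}" "P (l i) = i" if "i \<in> {1..n}" for i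
    using that bij_betw_imp_surj_on[OF P] inv_into_into[of i P "{1..n}"] f_inv_into_f[of i P "{1..n}"]
    by (simp_all add: l_def)
  have P_in: "P k \<in> {1..n}" if "k \<in> {1..n}" for k
    using bij_betwE[OF P] that by blast
  have Pl: "l (P k) = k" "P k \<in> {1..n}" if "k \<in> {1..n}" for k
    using bij_betw_inv_into_left[OF P that] P_in[OF that] by (simp_all add: l_def)
  have setL: "set L = {1..n+1}"
  proof (intro equalityI subsetI)
    fix v assume "v \<in> set L"
    then obtain i where i: "i \<le> n" "v = l i"
      unfolding L_def by (auto simp: less_Suc_eq_le simp del: upt_Suc)
    show "v \<in> {1..n+1}"
    proof (cases "i = 0")
      case True
      then show ?thesis using i by (simp add: l_def)
    next
      case False
      then show ?thesis using l_in(1)[of i] i by simp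
    qed
  next
    fix v assume v: "v \<in> {1..n+1}"
    obtain i where i: "i \<le> n" "v = l i"
    proof (cases "v = n + 1")
      case True
      then show thesis using that[of 0] by (simp add: l_def)
    next
      case False
      with v have "v \<in> {1..n}" by auto
      then show thesis using that[of "P v"] Pl[of v] by simp
    qed
    then have "L ! i = v" using nth by simp
    then show "v \<in> set L" using i lenL nth_mem[of i L] by simp
  qed
  have "distinct L" by (rule card_distinct) (simp add: setL lenL)
  moreover have "L ! 0 = n + 1" using nth[of 0] by (simp add: l_def)
  moreover have "c' (n + 1) = 0" by (simp add: c'_def)
  moreover have "successively (code_rel n c') L"
    unfolding successively_conv_nth
  proof (intro allI impI)
    fix i assume "Suc i < length L"
    then have i: "Suc i \<in> {1..n}" using lenL by simp
    have c1: "c' (l (Suc i)) = c (l (Suc i))" using l_in(1)[OF i] by (simp add: c'_def)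
    show "code_rel n c' (L ! i) (L ! Suc i)"
    proof (cases "i = 0")
      case True
      have "c (l (Suc i)) = 0" using first[OF l_in(1)[OF i]] l_in(2)[OF i] True by simp
      then show ?thesis using i c1 by (simp add: nth code_rel_def)
    next
      case False
      then have i': "i \<in> {1..n}" using i by simp
      have c2: "c' (l i) = c (l i)" "l i \<noteq> n + 1" using l_in(1)[OF i'] by (auto simp: c'_def)
      have "P (l (Suc i)) = Suc (P (l i))" using l_in(2)[OF i] l_in(2)[OF i'] by simp
      from step[OF l_in(1)[OF i'] l_in(1)[OF i] this] show ?thesis
        using i i' c1 c2 by (simp add: nth code_rel_def)
    qed
  qed
  ultimately obtain C V a S where run: "search_run n C V a S" and V: "V n = L"
    and S: "\<And>m. m \<le> n \<Longrightarrow> length (S m) = c' (a m)"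
    using code_search_run[of L n c'] setL by blast
  interpret search_run n C V a S by (rule run)
  show thesis
  proof
    show "labeled_tree n tree" by (rule tree)
    fix k assume k: "k \<in> {1..n}"
    show "nfs_position n tree k = P k"
      using nfs_position_nth[of "P k"] Pl[OF k] nth[of "P k"] by (simp add: V)
    have "k \<in> a ` {..n}" using k a_image by simp
    then obtain m where "m \<le> n" "k = a m" by auto
    then show "cane k = c k" using cane_a[of m] S[of m] k by (simp add: c'_def)
  qed
qed

lemma cane_number_eq_sum:
  assumes "labeled_tree n T"
  shows "cane_number n T = (\<Sum>k\<in>{1..n}. canes_from n T k)"
proof -
  obtain C V a S where run: "search_run n C V a S" and T: "T = search_prefix.forest C a n"
    using assms by (rule labeled_tree_run)
  interpret search_run n C V a S by (rule run)
  show ?thesis unfolding T cane_number_sum using canes_from_root by simp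
qed

section \<open>Chain simplices\<close>

definition chain :: "nat \<Rightarrow> real \<Rightarrow> (nat \<Rightarrow> real) \<Rightarrow> bool" where
  "chain n t z \<longleftrightarrow> 1 \<le> z 1 \<and> (\<forall>k\<in>{1..<n}. z k \<le> z (k + 1)) \<and> z n \<le> 1 + t"

text \<open>Coordinate \<open>q k\<close> belongs to label \<open>k\<close> and is divided by
  \<open>d k\<close>. Powers of \<open>1 + t\<close> as divisors give the tree simplices; divisors 1
  give the pieces of a cube from which the volume is obtained.\<close>

definition chain_simplex ::
    "(nat \<Rightarrow> 'n::finite) \<Rightarrow> (nat \<Rightarrow> real) \<Rightarrow> nat \<Rightarrow> real \<Rightarrow> (real ^ 'n) set" where
  "chain_simplex q d n t = {x. chain n t (\<lambda>k. x $ q k / d k)}"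

lemma chain_cong:
  assumes "n \<ge> 1" "\<And>k. k \<in> {1..n} \<Longrightarrow> z k = z' k"
  shows "chain n t z \<longleftrightarrow> chain n t z'"
proof -
  have "z 1 = z' 1" "z n = z' n" using assms by simp_all
  moreover have "z k \<le> z (k + 1) \<longleftrightarrow> z' k \<le> z' (k + 1)" if "k \<in> {1..<n}" for k
    using assms(2)[of k] assms(2)[of "k + 1"] that by simp
  ultimately show ?thesis unfolding chain_def by simp
qed

lemma chain_mono:
  assumes "chain n t z" "1 \<le> k" "k \<le> l" "l \<le> n"
  shows "z k \<le> z l"
  using assms(3,4)
proof (induction l rule: dec_induct)
  case (step l)
  then have "z l \<le> z (l + 1)" using assms(1,2) unfolding chain_def by auto
  with step show ?case by simp
qed simp

lemma chain_bounds:
  assumes "chain n t z" "k \<in> {1..n}"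
  shows "1 \<le> z k" "z k \<le> 1 + t"
  using chain_mono[OF assms(1), of 1 k] chain_mono[OF assms(1), of k n] assms
  unfolding chain_def by auto

section \<open>Simplices under linear maps and translations\<close>

lemma simplex_linear_image:
  assumes "n simplex S" "linear f" "inj f"
  shows "n simplex (f ` S)"
proof -
  obtain C where C: "\<not> affine_dependent C" "int (card C) = n + 1" "S = convex hull C"
    using assms(1) unfolding simplex_def by blast
  have "card (f ` C) = card C" using assms(3) by (intro card_image) (rule inj_on_subset, auto)
  moreover have "aff_dim (f ` C) = aff_dim C"
    using assms(2,3) by (rule aff_dim_injective_linear_image)
  ultimately have "\<not> affine_dependent (f ` C)"
    using C(1) unfolding affine_independent_iff_card by simp
  then show ?thesis
    unfolding simplex_def C(3) convex_hull_linear_image[OF assms(2)]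
    using C(2) \<open>card (f ` C) = card C\<close> by metis
qed

lemma simplex_translation:
  assumes "n simplex S"
  shows "n simplex ((+) a ` S)"
proof -
  obtain C where C: "\<not> affine_dependent C" "int (card C) = n + 1" "S = convex hull C"
    using assms unfolding simplex_def by blast
  have "\<not> affine_dependent ((+) a ` C)" using C(1) affine_dependent_translation_eq by blast
  moreover have "int (card ((+) a ` C)) = n + 1" using C(2) by (simp add: card_image)
  ultimately show ?thesis
    unfolding simplex_def C(3) using convex_hull_translation[of a C] by metis
qed

lemma simplex_std: "int DIM('a) simplex (convex hull (insert 0 Basis :: 'a::euclidean_space set))"
proof -
  have "\<not> affine_dependent (insert 0 Basis :: 'a set)"
    using affine_dependent_iff_dependent[of 0 "Basis :: 'a set"] independent_Basis by simp
  then show ?thesis unfolding simplex_def by (intro exI[of _ "insert 0 Basis"]) simp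
qed

lemma std_simplex_cart:
  "convex hull (insert 0 Basis) = {x :: real ^ 'n::finite. (\<forall>i. 0 \<le> x $ i) \<and> (\<Sum>i\<in>UNIV. x $ i) \<le> 1}"
proof -
  have B: "(Basis :: (real ^ 'n) set) = (\<lambda>i. axis i 1) ` UNIV"
    by (auto simp: Basis_vec_def)
  have "inj (\<lambda>i :: 'n. axis i (1 :: real))" by (auto simp: inj_on_def axis_eq_axis)
  then show ?thesis
    unfolding std_simplex unfolding B by (simp add: sum.reindex inner_axis)
qed

text \<open>Partial sums, scaled by \<open>t\<close> and shifted by 1, carry the standard simplex to
  the chain of inequalities; conversely, the gaps between consecutive coordinates, divided by
  \<open>t\<close>, are the standard coordinates.\<close>

lemma simplex_chain_unit:
  fixes e :: "nat \<Rightarrow> 'n::finite"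
  assumes n: "n \<ge> 1" and t: "t > 0" and e: "bij_betw e {1..n} UNIV"
  shows "int n simplex chain_simplex e (\<lambda>_. 1) n t"
proof -
  define m where "m = inv_into {1..n} e"
  have me: "m (e k) = k" if "k \<in> {1..n}" for k
    unfolding m_def using bij_betw_inv_into_left[OF e that] .
  have em: "e (m i) = i" and m_in: "m i \<in> {1..n}" for i
    using bij_betw_inv_into_right[OF e, of i] bij_betwE[OF bij_betw_inv_into[OF e]]
    by (auto simp: m_def)
  have dim: "DIM(real ^ 'n) = n" using bij_betw_same_card[OF e] by simp
  define f :: "real ^ 'n \<Rightarrow> real ^ 'n" where "f z = (\<chi> i. t * (\<Sum>j\<in>{1..m i}. z $ e j))" for z
  have f_nth: "f z $ e k = t * (\<Sum>j\<in>{1..k}. z $ e j)" if "k \<in> {1..n}" for z k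
    using that by (simp add: f_def me)
  have lin: "linear f"
    by (rule linearI)
      (simp_all add: f_def vec_eq_iff sum.distrib sum_distrib_left algebra_simps)
  have f_diff: "z $ e k = (f z $ e k - (if k = 1 then 0 else f z $ e (k - 1))) / t"
    if k: "k \<in> {1..n}" for z k
  proof -
    obtain l where l: "k = Suc l" using k by (cases k) auto
    show ?thesis
    proof (cases "l = 0")
      case True
      then show ?thesis using t f_nth[OF k] l by simp
    next
      case False
      then have "l \<in> {1..n}" using k l by simp
      then show ?thesis using t False f_nth[OF k, of z] f_nth[of l z] l
        by (simp add: algebra_simps)
    qed
  qed
  have inj: "inj f"
  proof (rule injI)
    fix z z' assume eq: "f z = f z'"
    have "z $ e (m i) = z' $ e (m i)" for i
      using f_diff[OF m_in[of i], of z] f_diff[OF m_in[of i], of z'] eq by simp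
    then show "z = z'" by (simp add: em vec_eq_iff)
  qed
  let ?one = "(\<chi> i. 1) :: real ^ 'n"
  let ?std = "{x :: real ^ 'n. (\<forall>i. 0 \<le> x $ i) \<and> (\<Sum>i\<in>UNIV. x $ i) \<le> 1}"
  have "chain_simplex e (\<lambda>_. 1) n t = (+) ?one ` f ` ?std"
  proof (intro equalityI subsetI)
    fix y assume "y \<in> chain_simplex e (\<lambda>_. 1) n t"
    then have y: "chain n t (\<lambda>k. y $ e k)" by (simp add: chain_simplex_def)
    \<comment> \<open>The value 1 at index 0 is the lower bound of the chain, so the first gap is
      \<open>y $ e 1 - 1\<close>.\<close>
    define Y where "Y k = (if k = 0 then 1 else y $ e k)" for k
    define z where "z = (\<chi> i. (Y (m i) - Y (m i - 1)) / t)"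
    have z_nth: "z $ e k = (Y k - Y (k - 1)) / t" if "k \<in> {1..n}" for k
      using that by (simp add: z_def me)
    have tele: "(\<Sum>j\<in>{1..k}. z $ e j) = (Y k - 1) / t" if "k \<le> n" for k
      using that
    proof (induction k)
      case 0
      then show ?case by (simp add: Y_def)
    next
      case (Suc k)
      then show ?case using z_nth[of "Suc k"] by (simp add: diff_divide_distrib)
    qed
    have "0 \<le> z $ i" for i
    proof -
      have "Y (m i - 1) \<le> Y (m i)"
      proof (cases "m i = 1")
        case True
        then show ?thesis using y by (simp add: Y_def chain_def)
      next
        case False
        with m_in[of i] have "1 \<le> m i - 1" "m i \<le> n" unfolding atLeastAtMost_iff by linarith+
        then show ?thesis using chain_mono[OF y, of "m i - 1" "m i"] by (auto simp: Y_def)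
      qed
      then show ?thesis using t by (simp add: z_def)
    qed
    moreover have "(\<Sum>i\<in>UNIV. z $ i) \<le> 1"
    proof -
      have "(\<Sum>i\<in>UNIV. z $ i) = (\<Sum>j\<in>{1..n}. z $ e j)"
        by (rule sum.reindex_bij_betw[OF e, symmetric])
      also have "\<dots> = (Y n - 1) / t" using tele by simp
      also have "\<dots> \<le> 1" using y n t by (simp add: Y_def chain_def field_simps)
      finally show ?thesis .
    qed
    moreover have "y = ?one + f z"
    proof -
      have "y $ e (m i) = (?one + f z) $ e (m i)" for i
        using f_nth[OF m_in[of i], of z] tele[of "m i"] m_in[of i] t by (simp add: Y_def)
      then show ?thesis by (simp add: em vec_eq_iff)
    qed
    ultimately show "y \<in> (+) ?one ` f ` ?std" by blast
  next
    fix y assume "y \<in> (+) ?one ` f ` ?std"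
    then obtain z where z: "\<And>i. 0 \<le> z $ i" "(\<Sum>i\<in>UNIV. z $ i) \<le> 1" "y = ?one + f z" by blast
    have y: "y $ e k = 1 + t * (\<Sum>j\<in>{1..k}. z $ e j)" if "k \<in> {1..n}" for k
      using f_nth[OF that] z(3) by simp
    have "(\<Sum>j\<in>{1..n}. z $ e j) \<le> 1" using z(2) sum.reindex_bij_betw[OF e, of "\<lambda>i. z $ i"] by simp
    then have "y $ e n \<le> 1 + t" using y[of n] n t by (simp add: mult_left_le)
    moreover have "1 \<le> y $ e 1" using y[of 1] n t z(1) by simp
    moreover have "y $ e k \<le> y $ e (k + 1)" if "k \<in> {1..<n}" for k
      using y[of k] y[of "k + 1"] that t z(1) by simp
    ultimately show "y \<in> chain_simplex e (\<lambda>_. 1) n t"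
      by (simp add: chain_simplex_def chain_def)
  qed
  moreover have "int n simplex ?std"
    using simplex_std[where 'a = "real ^ 'n"] unfolding dim std_simplex_cart .
  ultimately show ?thesis by (simp only: simplex_translation simplex_linear_image[OF _ lin inj])
qed

text \<open>Scaling and permuting coordinates sends boxes to boxes, and for a linear map it suffices
  to know the effect on the volume of boxes.\<close>

lemma measure_monomial_map:
  fixes d :: "'n::finite \<Rightarrow> real" and p :: "'n \<Rightarrow> 'n"
  assumes d: "\<And>i. d i > 0" and p: "bij p" and S: "S \<in> lmeasurable"
  defines "f \<equiv> \<lambda>y :: real ^ 'n. \<chi> i. d i * y $ p i"
  shows "measure lebesgue (f ` S) = (\<Prod>i\<in>UNIV. d i) * measure lebesgue S"
proof -
  have lin: "linear f" by (rule linearI) (simp_all add: f_def vec_eq_iff algebra_simps)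
  have image: "f ` cbox a b = cbox (f a) (f b)" for a b
  proof (intro equalityI subsetI)
    fix y assume y: "y \<in> cbox (f a) (f b)"
    define x where "x = (\<chi> j. y $ inv p j / d (inv p j))"
    have nth: "x $ p i = y $ i / d i" for i
      by (simp add: x_def inv_f_f[OF bij_is_inj[OF p]])
    have "f x $ i = y $ i" for i using d[of i] by (simp add: f_def nth)
    then have fx: "f x = y" by (simp add: vec_eq_iff)
    have "a $ p i \<le> x $ p i \<and> x $ p i \<le> b $ p i" for i
    proof -
      have "d i * a $ p i \<le> y $ i \<and> y $ i \<le> d i * b $ p i"
        using y unfolding mem_box_cart by (simp add: f_def)
      then show ?thesis using d[of i] unfolding nth by (simp add: field_simps)
    qed
    moreover have "\<exists>i. j = p i" for j by (rule surjD[OF bij_is_surj[OF p]])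
    ultimately have "x \<in> cbox a b" unfolding mem_box_cart by metis
    with fx show "y \<in> f ` cbox a b" by blast
  next
    fix y assume "y \<in> f ` cbox a b"
    then show "y \<in> cbox (f a) (f b)"
      using d unfolding mem_box_cart f_def by (auto simp: mem_box_cart less_imp_le)
  qed
  have "measure lebesgue (f ` cbox a b) = (\<Prod>i\<in>UNIV. d i) * measure lebesgue (cbox a b)" for a b
  proof (cases "cbox a b = {}")
    case False
    then have "cbox (f a) (f b) \<noteq> {}" using image by blast
    then have "measure lborel (cbox (f a) (f b)) = (\<Prod>i\<in>UNIV. d i * (b $ p i - a $ p i))"
      by (simp add: content_cbox_cart f_def algebra_simps)
    also have "\<dots> = (\<Prod>i\<in>UNIV. d i) * (\<Prod>i\<in>UNIV. b $ p i - a $ p i)"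
      by (rule prod.distrib)
    also have "(\<Prod>i\<in>UNIV. b $ p i - a $ p i) = (\<Prod>i\<in>UNIV. b $ i - a $ i)"
      by (rule prod.reindex_bij_betw[OF p])
    also have "\<dots> = measure lborel (cbox a b)" using False by (simp add: content_cbox_cart)
    finally show ?thesis by (simp add: image)
  qed simp
  from measure_linear_sufficient[OF lin S this] show ?thesis by simp
qed

text \<open>Coordinate \<open>i\<close> is taken from the coordinate that \<open>q'\<close> assigns
  to the label of \<open>i\<close> and is scaled by the divisor of that label. Shape and volume of
  every chain simplex thus reduce to one without divisors.\<close>

lemma chain_simplex_image:
  fixes q q' :: "nat \<Rightarrow> 'n::finite"
  assumes n: "n \<ge> 1" and q: "bij_betw q {1..n} UNIV" and q': "bij_betw q' {1..n} UNIV"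
    and d: "\<And>k. d k > 0"
  obtains c p where "\<forall>i. c i > 0" "bij p" "(\<Prod>i\<in>UNIV. c i) = (\<Prod>k\<in>{1..n}. d k)"
    "chain_simplex q d n t = (\<lambda>y. \<chi> i. c i * y $ p i) ` chain_simplex q' (\<lambda>_. 1) n t"
proof -
  define m where "m = inv_into {1..n} q"
  define m' where "m' = inv_into {1..n} q'"
  have m: "m (q k) = k" and m': "m' (q' k) = k" if "k \<in> {1..n}" for k
    using bij_betw_inv_into_left[OF q that] bij_betw_inv_into_left[OF q' that]
    by (simp_all add: m_def m'_def)
  have bm: "bij_betw m UNIV {1..n}" unfolding m_def using bij_betw_inv_into[OF q] .
  have qm: "q (m i) = i" and m_in: "m i \<in> {1..n}" for i
    using bij_betw_inv_into_right[OF q, of i] bij_betwE[OF bm] by (auto simp: m_def)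
  define c where "c i = d (m i)" for i
  define p where "p i = q' (m i)" for i
  define f :: "real ^ 'n \<Rightarrow> real ^ 'n" where "f y = (\<chi> i. c i * y $ p i)" for y
  have f: "f y $ q k / d k = y $ q' k" if "k \<in> {1..n}" for y k
    using d[of k] that by (simp add: f_def c_def p_def m)
  have "bij p" unfolding p_def using bij_betw_trans[OF bm q'] by (simp add: o_def)
  moreover have "(\<Prod>i\<in>UNIV. c i) = (\<Prod>k\<in>{1..n}. d k)"
    unfolding c_def by (rule prod.reindex_bij_betw[OF bm])
  moreover have "chain_simplex q d n t = f ` chain_simplex q' (\<lambda>_. 1) n t"
  proof (intro equalityI subsetI)
    fix x assume x: "x \<in> chain_simplex q d n t"
    define y where "y = (\<chi> i. x $ q (m' i) / d (m' i))"
    have y: "y $ q' k = x $ q k / d k" if "k \<in> {1..n}" for k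
      using that by (simp add: y_def m')
    have "x $ i = f y $ i" for i
      using y[OF m_in[of i]] d[of "m i"] by (simp add: f_def c_def p_def qm)
    then have "x = f y" by (simp add: vec_eq_iff)
    moreover have "y \<in> chain_simplex q' (\<lambda>_. 1) n t"
      using x chain_cong[OF n, of "\<lambda>k. y $ q' k / 1" "\<lambda>k. x $ q k / d k" t] y
      by (simp add: chain_simplex_def)
    ultimately show "x \<in> f ` chain_simplex q' (\<lambda>_. 1) n t" by blast
  next
    fix x assume "x \<in> f ` chain_simplex q' (\<lambda>_. 1) n t"
    then obtain y where y: "y \<in> chain_simplex q' (\<lambda>_. 1) n t" "x = f y" by blast
    then show "x \<in> chain_simplex q d n t"
      using chain_cong[OF n, of "\<lambda>k. y $ q' k / 1" "\<lambda>k. f y $ q k / d k" t] f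
      by (simp add: chain_simplex_def)
  qed
  moreover have "\<forall>i. c i > 0" using d by (simp add: c_def)
  ultimately show thesis using that[of c p] unfolding f_def by simp
qed

lemma simplex_chain_simplex:
  fixes q :: "nat \<Rightarrow> 'n::finite"
  assumes n: "n \<ge> 1" and t: "t > 0" and q: "bij_betw q {1..n} UNIV" and d: "\<And>k. d k > 0"
  shows "int n simplex chain_simplex q d n t"
proof -
  obtain c p where cp: "\<forall>i. c i > 0" "bij p" "(\<Prod>i\<in>UNIV. c i) = (\<Prod>k\<in>{1..n}. d k)"
    "chain_simplex q d n t = (\<lambda>y. \<chi> i. c i * y $ p i) ` chain_simplex q (\<lambda>_. 1) n t"
    by (rule chain_simplex_image[where d = d and t = t, OF n q q d])
  let ?f = "\<lambda>y :: real ^ 'n. (\<chi> i. c i * y $ p i) :: real ^ 'n"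
  have "linear ?f" by (rule linearI) (simp_all add: vec_eq_iff algebra_simps)
  moreover have "inj ?f"
  proof (rule injI)
    fix x y assume "?f x = ?f y"
    then have eq: "c i * x $ p i = c i * y $ p i" for i unfolding vec_eq_iff by simp
    have "x $ p i = y $ p i" for i using eq[of i] cp(1)[rule_format, of i] by simp
    moreover have "\<exists>i. j = p i" for j by (rule surjD[OF bij_is_surj[OF cp(2)]])
    ultimately show "x = y" unfolding vec_eq_iff by metis
  qed
  ultimately show ?thesis
    unfolding cp(4) using simplex_chain_unit[OF n t q] by (intro simplex_linear_image)
qed

section \<open>Interior points and the order of their coordinates\<close>

lemma interior_axis:
  fixes x :: "real ^ 'n::finite"
  assumes "x \<in> interior S"
  obtains \<epsilon> where "\<epsilon> > 0" "\<And>i. x + axis i \<epsilon> \<in> S" "\<And>i. x - axis i \<epsilon> \<in> S"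
proof -
  obtain \<epsilon> where \<epsilon>: "\<epsilon> > 0" "cball x \<epsilon> \<subseteq> S" using assms unfolding mem_interior_cball by blast
  have "axis i \<epsilon> = \<epsilon> *\<^sub>R (axis i 1 :: real ^ 'n)" for i by (simp add: axis_def vec_eq_iff)
  then have "norm (axis i \<epsilon> :: real ^ 'n) = \<epsilon>" for i using \<epsilon>(1) by simp
  then have "x + axis i \<epsilon> \<in> cball x \<epsilon>" "x - axis i \<epsilon> \<in> cball x \<epsilon>" for i
    by (simp_all add: dist_norm)
  with \<epsilon> that show thesis by blast
qed

text \<open>An interior point can be moved a little along a single axis in both directions. The
  inequalities still hold after the move, so they are strict at the point itself.\<close>

lemma interior_chain_simplex:
  fixes q :: "nat \<Rightarrow> 'n::finite"
  assumes n: "n \<ge> 1" and q: "bij_betw q {1..n} UNIV" and d: "\<And>k. d k > 0"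
    and x: "x \<in> interior (chain_simplex q d n t)"
  shows "\<And>k. k \<in> {1..n} \<Longrightarrow> 1 < x $ q k / d k" "\<And>k. k \<in> {1..n} \<Longrightarrow> x $ q k / d k < 1 + t"
    "\<And>k l. 1 \<le> k \<Longrightarrow> k < l \<Longrightarrow> l \<le> n \<Longrightarrow> x $ q k / d k < x $ q l / d l"
proof -
  obtain \<epsilon> where \<epsilon>: "\<epsilon> > 0" "\<And>i. x + axis i \<epsilon> \<in> chain_simplex q d n t"
    "\<And>i. x - axis i \<epsilon> \<in> chain_simplex q d n t"
    using interior_axis[OF x] by blast
  have up: "chain n t (\<lambda>k. (x + axis i \<epsilon>) $ q k / d k)"
    and down: "chain n t (\<lambda>k. (x - axis i \<epsilon>) $ q k / d k)" for i
    using \<epsilon>(2,3)[of i] by (simp_all add: chain_simplex_def)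
  have pos: "0 < \<epsilon> / d k" for k using \<epsilon>(1) d[of k] by simp
  show "1 < x $ q k / d k" if "k \<in> {1..n}" for k
    using chain_bounds(1)[OF down[of "q k"] that] pos[of k] by (simp add: axis_def diff_divide_distrib)
  show "x $ q k / d k < 1 + t" if "k \<in> {1..n}" for k
    using chain_bounds(2)[OF up[of "q k"] that] pos[of k] by (simp add: axis_def add_divide_distrib)
  show "x $ q k / d k < x $ q l / d l" if "1 \<le> k" "k < l" "l \<le> n" for k l
  proof -
    have "q k \<noteq> q l"
      using inj_on_eq_iff[OF bij_betw_imp_inj_on[OF q], of k l] that by simp
    then show ?thesis
      using chain_mono[OF down[of "q l"], of k l] that pos[of l]
      by (simp add: axis_def diff_divide_distrib)
  qed
qed

text \<open>Both bijections list the same values of \<open>Y\<close> in strictly increasing order,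
  so the lists agree, and equal values of \<open>Y\<close> come from equal indices.\<close>

lemma increasing_bij_unique:
  fixes Y :: "nat \<Rightarrow> real"
  assumes P: "bij_betw P {1..n} {1..n}" and P': "bij_betw P' {1..n} {1..n}"
    and inc: "\<And>k l. 1 \<le> k \<Longrightarrow> k < l \<Longrightarrow> l \<le> n \<Longrightarrow> Y (P k) < Y (P l)"
    and inc': "\<And>k l. 1 \<le> k \<Longrightarrow> k < l \<Longrightarrow> l \<le> n \<Longrightarrow> Y (P' k) < Y (P' l)"
    and k: "k \<in> {1..n}"
  shows "P k = P' k"
proof -
  have strict: "sorted_wrt (<) (map (\<lambda>k. Y (Q k)) [1..<Suc n])"
    if "\<And>k l. 1 \<le> k \<Longrightarrow> k < l \<Longrightarrow> l \<le> n \<Longrightarrow> Y (Q k) < Y (Q l)" for Q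
    unfolding sorted_wrt_iff_nth_less using that by (simp del: upt_Suc)
  have set: "set (map (\<lambda>k. Y (Q k)) [1..<Suc n]) = Y ` {1..n}" if "bij_betw Q {1..n} {1..n}" for Q
  proof -
    have "set (map (\<lambda>k. Y (Q k)) [1..<Suc n]) = Y ` (Q ` {1..n})"
      unfolding image_image by (simp add: atLeastLessThanSuc_atLeastAtMost del: upt_Suc)
    then show ?thesis unfolding bij_betw_imp_surj_on[OF that] .
  qed
  have "map (\<lambda>k. Y (P k)) [1..<Suc n] = map (\<lambda>k. Y (P' k)) [1..<Suc n]"
    by (rule sorted_distinct_set_unique)
      (use strict[of P, OF inc] strict[of P', OF inc'] set[OF P] set[OF P'] in
        \<open>simp_all only: strict_sorted_iff\<close>)
  then have eq: "Y (P k) = Y (P' k)" using k by (simp add: map_eq_conv del: upt_Suc)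
  have "P' k \<in> P ` {1..n}" using bij_betw_imp_surj_on[OF P] bij_betwE[OF P'] k by blast
  then obtain l where l: "l \<in> {1..n}" "P' k = P l" by blast
  have "k = l"
  proof (rule ccontr)
    assume "k \<noteq> l"
    then consider "k < l" | "l < k" by linarith
    then show False
      by cases (use inc[of k l] inc[of l k] eq k l in simp_all)
  qed
  with l show ?thesis by simp
qed

text \<open>
  Later indices come first among equal values because \<open>x\<^sub>i = (1 + t) x\<^bsub>i-1\<^esub>\<close> requires the node at
  position \<open>i\<close> to have the smaller label.
\<close>

lemma ranking_exists:
  fixes y :: "nat \<Rightarrow> real"
  obtains lab where "bij_betw lab {1..n} {1..n}"
    "\<And>i j. i \<in> {1..n} \<Longrightarrow> j \<in> {1..n} \<Longrightarrow> y i < y j \<or> y i = y j \<and> j < i \<Longrightarrow> lab i < lab j"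
proof -
  define R where "R i j \<longleftrightarrow> y i < y j \<or> y i = y j \<and> j \<le> i" for i j :: nat
  define lab where "lab i = card {j \<in> {1..n}. R j i}" for i
  have less: "lab i < lab j" if "i \<in> {1..n}" "j \<in> {1..n}" "y i < y j \<or> y i = y j \<and> j < i" for i j
    unfolding lab_def
  proof (rule psubset_card_mono)
    have "j \<in> {k \<in> {1..n}. R k j}" "j \<notin> {k \<in> {1..n}. R k i}" using that by (auto simp: R_def)
    moreover have "{k \<in> {1..n}. R k i} \<subseteq> {k \<in> {1..n}. R k j}" using that by (auto simp: R_def)
    ultimately show "{k \<in> {1..n}. R k i} \<subset> {k \<in> {1..n}. R k j}" by blast
  qed simp
  have "inj_on lab {1..n}"
  proof (rule inj_onI)
    fix i j assume ij: "i \<in> {1..n}" "j \<in> {1..n}" "lab i = lab j"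
    show "i = j"
    proof (rule ccontr)
      assume "i \<noteq> j"
      then have "(y i < y j \<or> y i = y j \<and> j < i) \<or> (y j < y i \<or> y j = y i \<and> i < j)" by auto
      with less[of i j] less[of j i] ij show False by auto
    qed
  qed
  moreover have "lab ` {1..n} \<subseteq> {1..n}"
  proof safe
    fix i assume i: "i \<in> {1..n}"
    have "card {i} \<le> lab i" unfolding lab_def by (intro card_mono) (use i in \<open>auto simp: R_def\<close>)
    moreover have "lab i \<le> card {1..n}" unfolding lab_def by (intro card_mono) auto
    ultimately show "lab i \<in> {1..n}" by simp
  qed
  ultimately have "bij_betw lab {1..n} {1..n}"
    by (simp add: bij_betw_def endo_inj_surj)
  with less that show thesis by blast
qed

text \<open>A common point that is not interior to both closed sets lies on one of the frontiers,
  and the frontier of a convex set is negligible.\<close>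

lemma negligible_simplex_Int:
  fixes A B :: "'a::euclidean_space set"
  assumes "n simplex A" "m simplex B" "interior A \<inter> interior B = {}"
  shows "negligible (A \<inter> B)"
proof -
  have "A \<inter> B \<subseteq> frontier A \<union> frontier B"
    using assms closure_closed[OF closed_simplex[OF assms(1)]]
      closure_closed[OF closed_simplex[OF assms(2)]] unfolding frontier_def by blast
  moreover have "negligible (frontier A \<union> frontier B)"
    using assms(1,2) by (simp add: negligible_Un_eq negligible_convex_frontier convex_simplex)
  ultimately show ?thesis by (rule negligible_subset[rotated])
qed

text \<open>The coordinate permutations of one chain simplex tile a cube.\<close>

lemma measure_chain_unit:
  fixes e :: "nat \<Rightarrow> 'n::finite"
  assumes n: "n \<ge> 1" and t: "t > 0" and e: "bij_betw e {1..n} UNIV"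
  shows "fact n * measure lebesgue (chain_simplex e (\<lambda>_. 1) n t) = t ^ n"
proof -
  let ?P = "{\<sigma>. \<sigma> permutes {1..n}}"
  let ?S = "\<lambda>\<sigma>. chain_simplex (e \<circ> \<sigma>) (\<lambda>_. 1) n t"
  let ?cube = "cbox (\<chi> i. 1) (\<chi> i. 1 + t) :: (real ^ 'n) set"
  have bij: "bij_betw \<sigma> {1..n} {1..n}" if "\<sigma> \<in> ?P" for \<sigma>
    using that permutes_imp_bij by blast
  then have e\<sigma>: "bij_betw (e \<circ> \<sigma>) {1..n} UNIV" if "\<sigma> \<in> ?P" for \<sigma>
    using bij_betw_trans[OF _ e] that by blast
  have simplex: "int n simplex ?S \<sigma>" if "\<sigma> \<in> ?P" for \<sigma>
    using simplex_chain_simplex[OF n t e\<sigma>[OF that], of "\<lambda>_. 1"] by simp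
  have lm: "?S \<sigma> \<in> lmeasurable" if "\<sigma> \<in> ?P" for \<sigma>
    using compact_simplex[OF simplex[OF that]] by (rule lmeasurable_compact)
  have id: "id \<in> ?P" by (simp add: permutes_id)
  \<comment> \<open>Without divisors, the simplices differ by a map whose scale factors have product
    1.\<close>
  have same: "measure lebesgue (?S \<sigma>) = measure lebesgue (chain_simplex e (\<lambda>_. 1) n t)" if \<sigma>: "\<sigma> \<in> ?P" for \<sigma>
  proof -
    obtain c p where cp: "\<forall>i. c i > (0 :: real)" "bij p" "(\<Prod>i\<in>UNIV. c i) = (\<Prod>k\<in>{1..n}. 1)"
      "?S \<sigma> = (\<lambda>y. \<chi> i. c i * y $ p i) ` chain_simplex e (\<lambda>_. 1) n t"
      by (rule chain_simplex_image[where d = "\<lambda>_. 1" and t = t, OF n e\<sigma>[OF \<sigma>] e zero_less_one])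
    have "chain_simplex e (\<lambda>_. 1) n t \<in> lmeasurable" using lm[OF id] by simp
    from measure_monomial_map[of c p, OF _ cp(2) this] show ?thesis unfolding cp(4) using cp(1,3) by simp
  qed
  have cover: "\<Union> (?S ` ?P) = ?cube"
  proof (intro equalityI subsetI)
    fix x assume "x \<in> \<Union> (?S ` ?P)"
    then obtain \<sigma> where \<sigma>: "\<sigma> \<in> ?P" "x \<in> ?S \<sigma>" by blast
    then have x: "chain n t (\<lambda>k. x $ e (\<sigma> k))" by (simp add: chain_simplex_def)
    have "1 \<le> x $ i \<and> x $ i \<le> 1 + t" for i
    proof -
      have "i \<in> (e \<circ> \<sigma>) ` {1..n}" using e\<sigma>[OF \<sigma>(1)] by (simp add: bij_betw_def)
      then obtain k where "k \<in> {1..n}" "i = e (\<sigma> k)" by auto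
      with chain_bounds[OF x] show ?thesis by simp
    qed
    then show "x \<in> ?cube" by (simp add: mem_box_cart)
  next
    fix x assume "x \<in> ?cube"
    then have x: "1 \<le> x $ i" "x $ i \<le> 1 + t" for i by (simp_all add: mem_box_cart)
    obtain lab where lab: "bij_betw lab {1..n} {1..n}"
      "\<And>i j. i \<in> {1..n} \<Longrightarrow> j \<in> {1..n} \<Longrightarrow> x $ e i < x $ e j \<or> x $ e i = x $ e j \<and> j < i \<Longrightarrow> lab i < lab j"
      using ranking_exists[of n "\<lambda>i. x $ e i"] by blast
    define P where "P = inv_into {1..n} lab"
    have bP: "bij_betw P {1..n} {1..n}" unfolding P_def by (rule bij_betw_inv_into[OF lab(1)])
    have P: "P k \<in> {1..n}" "lab (P k) = k" if "k \<in> {1..n}" for k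
      using bij_betwE[OF bP] bij_betw_inv_into_right[OF lab(1) that] that by (auto simp: P_def)
    define \<sigma> where "\<sigma> k = (if k \<in> {1..n} then P k else k)" for k
    have "bij_betw \<sigma> {1..n} {1..n}" using bP bij_betw_cong[of "{1..n}" P \<sigma>] by (simp add: \<sigma>_def)
    then have "\<sigma> permutes {1..n}" by (rule bij_imp_permutes) (auto simp: \<sigma>_def)
    moreover have "chain n t (\<lambda>k. x $ e (\<sigma> k))"
      unfolding chain_def
    proof (intro conjI ballI)
      fix k assume k: "k \<in> {1..<n}"
      then have k': "k \<in> {1..n}" "k + 1 \<in> {1..n}" by auto
      show "x $ e (\<sigma> k) \<le> x $ e (\<sigma> (k + 1))"
      proof (rule ccontr)
        assume "\<not> x $ e (\<sigma> k) \<le> x $ e (\<sigma> (k + 1))"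
        then have "x $ e (P (k + 1)) < x $ e (P k)" using k' by (simp add: \<sigma>_def)
        then have "lab (P (k + 1)) < lab (P k)" using lab(2) P(1) k' by blast
        then show False using P(2)[of k] P(2)[of "k + 1"] k' by simp
      qed
    qed (use x in auto)
    ultimately show "x \<in> \<Union> (?S ` ?P)" by (auto simp: chain_simplex_def)
  qed
  have "pairwise (\<lambda>\<sigma> \<tau>. negligible (?S \<sigma> \<inter> ?S \<tau>)) ?P"
  proof (rule pairwiseI)
    fix \<sigma> \<tau> assume st: "\<sigma> \<in> ?P" "\<tau> \<in> ?P" "\<sigma> \<noteq> \<tau>"
    have "interior (?S \<sigma>) \<inter> interior (?S \<tau>) = {}"
    proof (rule ccontr)
      assume "interior (?S \<sigma>) \<inter> interior (?S \<tau>) \<noteq> {}"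
      then obtain x where x: "x \<in> interior (?S \<sigma>)" "x \<in> interior (?S \<tau>)" by blast
      have inc: "x $ e (\<rho> k) < x $ e (\<rho> l)"
        if "\<rho> \<in> ?P" "x \<in> interior (?S \<rho>)" "1 \<le> k" "k < l" "l \<le> n" for \<rho> k l
        using interior_chain_simplex(3)[OF n e\<sigma>[OF that(1)] _ that(2-5)] by simp
      \<comment> \<open>An interior point has distinct coordinates, and only one permutation lists
        them in increasing order.\<close>
      have "\<sigma> k = \<tau> k" if "k \<in> {1..n}" for k
      proof (rule increasing_bij_unique[of \<sigma> n \<tau> "\<lambda>i. x $ e i"])
        show "x $ e (\<sigma> k) < x $ e (\<sigma> l)" if "1 \<le> k" "k < l" "l \<le> n" for k l
          using inc[OF st(1) x(1) that] .
        show "x $ e (\<tau> k) < x $ e (\<tau> l)" if "1 \<le> k" "k < l" "l \<le> n" for k l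
          using inc[OF st(2) x(2) that] .
      qed (rule bij[OF st(1)] bij[OF st(2)] that)+
      moreover have "\<sigma> k = \<tau> k" if "k \<notin> {1..n}" for k
        using st that by (simp add: permutes_def)
      ultimately have "\<sigma> = \<tau>" by blast
      with st show False by simp
    qed
    then show "negligible (?S \<sigma> \<inter> ?S \<tau>)"
      using negligible_simplex_Int simplex st(1,2) by blast
  qed
  then have "measure lebesgue ?cube = (\<Sum>\<sigma>\<in>?P. measure lebesgue (?S \<sigma>))"
    unfolding cover[symmetric] using lm
    by (intro measure_negligible_finite_Union_image) (simp_all add: finite_permutations)
  also have "\<dots> = (\<Sum>\<sigma>\<in>?P. measure lebesgue (chain_simplex e (\<lambda>_. 1) n t))"
    by (rule sum.cong) (simp_all only: same)
  also have "\<dots> = fact n * measure lebesgue (chain_simplex e (\<lambda>_. 1) n t)"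
    using card_permutations[of "{1..n}" n] by simp
  also have "measure lebesgue ?cube = t ^ n"
  proof -
    have "?cube \<noteq> {}" using t by (auto simp: interval_ne_empty_cart)
    then have "measure lebesgue ?cube = t ^ CARD('n)" by (simp add: content_cbox_cart)
    also have "CARD('n) = n" using bij_betw_same_card[OF e] by simp
    finally show ?thesis .
  qed
  finally show ?thesis by simp
qed

lemma measure_chain_simplex:
  fixes q :: "nat \<Rightarrow> 'n::finite"
  assumes n: "n \<ge> 1" and t: "t > 0" and q: "bij_betw q {1..n} UNIV" and d: "\<And>k. d k > 0"
  shows "fact n * measure lebesgue (chain_simplex q d n t) = t ^ n * (\<Prod>k\<in>{1..n}. d k)"
proof -
  obtain c p where cp: "\<forall>i. c i > 0" "bij p" "(\<Prod>i\<in>UNIV. c i) = (\<Prod>k\<in>{1..n}. d k)"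
    "chain_simplex q d n t = (\<lambda>y. \<chi> i. c i * y $ p i) ` chain_simplex q (\<lambda>_. 1) n t"
    by (rule chain_simplex_image[where d = d and t = t, OF n q q d])
  have "chain_simplex q (\<lambda>_. 1) n t \<in> lmeasurable"
    using compact_simplex[OF simplex_chain_unit[OF n t q]] by (rule lmeasurable_compact)
  from measure_monomial_map[of c p, OF _ cp(2) this] show ?thesis
    using measure_chain_unit[OF n t q] cp(1) unfolding cp(4) by (simp add: cp(3) algebra_simps)
qed

section \<open>The triangulation\<close>

lemma tree_simplex_chain:
  "tree_simplex e n t T =
    chain_simplex (e \<circ> nfs_position n T) (\<lambda>k. (1 + t) ^ canes_from n T k) n t"
  by (simp add: tree_simplex_def chain_simplex_def chain_def Let_def)

lemma bij_betw_nfs_coordinate: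
  assumes "bij_betw e {1..n} UNIV" "labeled_tree n T"
  shows "bij_betw (e \<circ> nfs_position n T) {1..n} UNIV"
  using bij_betw_trans[OF nfs_position_bij[OF assms(2)] assms(1)] .

lemma simplex_tree_simplex:
  fixes e :: "nat \<Rightarrow> 'n::finite"
  assumes "n \<ge> 1" "t > 0" "bij_betw e {1..n} UNIV" "labeled_tree n T"
  shows "int n simplex tree_simplex e n t T"
  unfolding tree_simplex_chain
  by (rule simplex_chain_simplex) (use assms bij_betw_nfs_coordinate in simp_all)

lemma measure_tree_simplex:
  fixes e :: "nat \<Rightarrow> 'n::finite"
  assumes "n \<ge> 1" "t > 0" "bij_betw e {1..n} UNIV" "labeled_tree n T"
  shows "fact n * measure lebesgue (tree_simplex e n t T) = t ^ n * (1 + t) ^ cane_number n T"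
proof -
  have "(\<Prod>k\<in>{1..n}. (1 + t) ^ canes_from n T k) = (1 + t) ^ cane_number n T"
    unfolding cane_number_eq_sum[OF assms(4)] by (rule power_sum[symmetric])
  moreover have "fact n * measure lebesgue (tree_simplex e n t T) =
      t ^ n * (\<Prod>k\<in>{1..n}. (1 + t) ^ canes_from n T k)"
    unfolding tree_simplex_chain
    by (rule measure_chain_simplex) (use assms bij_betw_nfs_coordinate in simp_all)
  ultimately show ?thesis by simp
qed

lemma power_interval_unique:
  fixes b :: real
  assumes "b > 1" "b ^ i < x" "x < b ^ Suc i" "b ^ j < x" "x < b ^ Suc j"
  shows "i = j"
proof -
  have "b ^ i < b ^ Suc j" "b ^ j < b ^ Suc i" using assms by linarith+
  then have "i < Suc j" "j < Suc i" using power_strict_increasing_iff[OF assms(1)] by blast+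
  then show ?thesis by simp
qed

text \<open>
  An interior point determines the tree: its coordinates determine the numbers of cane paths by
  position, and the order of the rescaled coordinates determines the labels by position.
\<close>

lemma interior_tree_simplex_disjoint:
  fixes e :: "nat \<Rightarrow> 'n::finite"
  assumes n: "n \<ge> 1" and t: "t > 0" and e: "bij_betw e {1..n} UNIV"
    and T: "labeled_tree n T" and T': "labeled_tree n T'" and ne: "T \<noteq> T'"
  shows "interior (tree_simplex e n t T) \<inter> interior (tree_simplex e n t T') = {}"
proof (rule ccontr)
  assume "interior (tree_simplex e n t T) \<inter> interior (tree_simplex e n t T') \<noteq> {}"
  then obtain x where x: "x \<in> interior (tree_simplex e n t T)" "x \<in> interior (tree_simplex e n t T')"
    by blast
  \<comment> \<open>Coordinates are indexed by positions, so the numbers of cane paths are too; the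
    labels at a position are not yet known to agree in the two trees.\<close>
  define j where "j T i = canes_from n T (inv_into {1..n} (nfs_position n T) i)" for T i
  have d: "(0 :: real) < (1 + t) ^ c" for c using t by simp
  have j_pos: "j U (nfs_position n U k) = canes_from n U k"
    if "labeled_tree n U" "k \<in> {1..n}" for U k
    using bij_betw_inv_into_left[OF nfs_position_bij[OF that(1)] that(2)] by (simp add: j_def)
  have strict: "(1 + t) ^ j U i < x $ e i \<and> x $ e i < (1 + t) ^ Suc (j U i)"
    if U: "labeled_tree n U" "x \<in> interior (tree_simplex e n t U)" and i: "i \<in> {1..n}" for U i
  proof -
    have "i \<in> nfs_position n U ` {1..n}"
      using bij_betw_imp_surj_on[OF nfs_position_bij[OF U(1)]] i by simp
    then obtain k where k: "k \<in> {1..n}" "i = nfs_position n U k" by blast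
    have "1 < x $ e i / (1 + t) ^ j U i" "x $ e i / (1 + t) ^ j U i < 1 + t"
      using interior_chain_simplex(1,2)[OF n bij_betw_nfs_coordinate[OF e U(1)] d
          U(2)[unfolded tree_simplex_chain] k(1)] k j_pos[OF U(1) k(1)] by simp_all
    then show ?thesis using d[of "j U i"] by (simp add: field_simps)
  qed
  have inc: "x $ e (nfs_position n U k) / (1 + t) ^ j U (nfs_position n U k)
      < x $ e (nfs_position n U l) / (1 + t) ^ j U (nfs_position n U l)"
    if U: "labeled_tree n U" "x \<in> interior (tree_simplex e n t U)"
      and kl: "1 \<le> k" "k < l" "l \<le> n" for U k l
  proof -
    have "k \<in> {1..n}" "l \<in> {1..n}" using kl by simp_all
    then show ?thesis
      using interior_chain_simplex(3)[OF n bij_betw_nfs_coordinate[OF e U(1)] d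
          U(2)[unfolded tree_simplex_chain] kl] by (simp add: j_pos[OF U(1)])
  qed
  have jj: "j T i = j T' i" if "i \<in> {1..n}" for i
    using strict[OF T x(1) that] strict[OF T' x(2) that] t
    by (intro power_interval_unique[of "1 + t" "j T i" "x $ e i" "j T' i"]) simp_all
  \<comment> \<open>As the exponents agree, the same rescaled coordinates serve both trees, and
    their increasing order fixes the positions.\<close>
  have pos: "nfs_position n T k = nfs_position n T' k" if k: "k \<in> {1..n}" for k
  proof (rule increasing_bij_unique[OF nfs_position_bij[OF T] nfs_position_bij[OF T'] _ _ k,
        where Y = "\<lambda>i. x $ e i / (1 + t) ^ j T i"])
    fix k l assume kl: "1 \<le> k" "k < l" "l \<le> n"
    show "x $ e (nfs_position n T k) / (1 + t) ^ j T (nfs_position n T k)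
      < x $ e (nfs_position n T l) / (1 + t) ^ j T (nfs_position n T l)"
      by (rule inc[OF T x(1) kl])
    have "nfs_position n T' k \<in> {1..n}" "nfs_position n T' l \<in> {1..n}"
      using bij_betwE[OF nfs_position_bij[OF T']] kl by simp_all
    then show "x $ e (nfs_position n T' k) / (1 + t) ^ j T (nfs_position n T' k)
      < x $ e (nfs_position n T' l) / (1 + t) ^ j T (nfs_position n T' l)"
      using inc[OF T' x(2) kl] by (simp only: jj)
  qed
  have "canes_from n T k = canes_from n T' k" if k: "k \<in> {1..n}" for k
  proof -
    have "nfs_position n T k \<in> {1..n}" using bij_betwE[OF nfs_position_bij[OF T]] k by blast
    from jj[OF this] show ?thesis using j_pos[OF T k] j_pos[OF T' k] pos[OF k] by simp
  qed
  with pos have "T = T'" by (intro labeled_tree_eqI[OF T T'])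
  with ne show False ..
qed

text \<open>At consecutive positions, if the height does not rise, then
  \<open>z k' \<le> 1 + t \<le> (1 + t) * z k\<close> suffices for any labels. If it rises by one,
  the factor \<open>1 + t\<close> is used up, and the smaller label gives
  \<open>z k' \<le> z k\<close>.\<close>

lemma tree_simplex_subset:
  fixes e :: "nat \<Rightarrow> 'n::finite"
  assumes n: "n \<ge> 1" and t: "t > 0" and T: "labeled_tree n T"
  shows "tree_simplex e n t T \<subseteq> cayley_polytope e n t"
proof
  fix x assume "x \<in> tree_simplex e n t T"
  define z where "z k = x $ e (nfs_position n T k) / (1 + t) ^ canes_from n T k" for k
  have z: "chain n t z"
    using \<open>x \<in> tree_simplex e n t T\<close> unfolding tree_simplex_chain chain_simplex_def z_def by simp
  have x: "x $ e (nfs_position n T k) = (1 + t) ^ canes_from n T k * z k" for k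
    using t by (simp add: z_def)
  have label: "\<exists>k\<in>{1..n}. i = nfs_position n T k" if "i \<in> {1..n}" for i
    using bij_betw_imp_surj_on[OF nfs_position_bij[OF T]] that by blast
  have ge: "1 \<le> x $ e i" if i: "i \<in> {1..n}" for i
  proof -
    obtain k where k: "k \<in> {1..n}" "i = nfs_position n T k" using label[OF i] by blast
    have "1 * 1 \<le> (1 + t) ^ canes_from n T k * z k"
      using t chain_bounds(1)[OF z k(1)] by (intro mult_mono one_le_power) simp_all
    then show ?thesis using x[of k] k(2) by simp
  qed
  have "x $ e 1 \<le> 1 + t"
  proof -
    obtain k where k: "k \<in> {1..n}" "1 = nfs_position n T k" using label[of 1] n by auto
    have "canes_from n T k = 0" using canes_from_first[OF T k(1) k(2)[symmetric]] .
    then show ?thesis using x[of k] chain_bounds(2)[OF z k(1)] unfolding k(2)[symmetric] by simp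
  qed
  moreover have "x $ e i \<le> (1 + t) * x $ e (i - 1)" if i: "i \<in> {2..n}" for i
  proof -
    have i1: "i \<in> {1..n}" "i - 1 \<in> {1..n}" using i by auto
    obtain k where k: "k \<in> {1..n}" "i - 1 = nfs_position n T k" using label[OF i1(2)] by blast
    obtain k' where k': "k' \<in> {1..n}" "i = nfs_position n T k'" using label[OF i1(1)] by blast
    have "nfs_position n T k' = Suc (nfs_position n T k)"
      unfolding k(2)[symmetric] k'(2)[symmetric] using i by simp
    from canes_from_step[OF T k(1) k'(1) this]
    have "(1 + t) ^ canes_from n T k' * z k' \<le> (1 + t) * ((1 + t) ^ canes_from n T k * z k)"
    proof
      assume le: "canes_from n T k' \<le> canes_from n T k"
      have "(1 + t) ^ canes_from n T k' * z k' \<le> (1 + t) ^ canes_from n T k * (1 + t)"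
        using t le chain_bounds[OF z k'(1)] by (intro mult_mono power_increasing) simp_all
      also have "\<dots> \<le> (1 + t) ^ canes_from n T k * ((1 + t) * z k)"
        using t chain_bounds(1)[OF z k(1)] by (intro mult_left_mono) simp_all
      finally show ?thesis by (simp only: ac_simps)
    next
      assume s: "canes_from n T k' = Suc (canes_from n T k) \<and> k' < k"
      then have "z k' \<le> z k" using chain_mono[OF z, of k' k] k k' by simp
      then have "(1 + t) ^ canes_from n T k' * z k' \<le> (1 + t) ^ canes_from n T k' * z k"
        using t by (intro mult_left_mono) simp_all
      then show ?thesis using s by (simp add: mult.assoc)
    qed
    then show ?thesis using x[of k] x[of k'] unfolding k(2)[symmetric] k'(2)[symmetric] by simp
  qed
  ultimately show "x \<in> cayley_polytope e n t" using ge n by (simp add: cayley_polytope_def)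
qed

text \<open>
  The number \<open>j i\<close> below is the exponent of \<open>x\<^sub>i\<close>; with half-open intervals that contain their
  right end point, also the points on the boundaries of the simplices are covered.
\<close>

lemma cayley_polytope_covered:
  fixes e :: "nat \<Rightarrow> 'n::finite"
  assumes n: "n \<ge> 1" and t: "t > 0" and x: "x \<in> cayley_polytope e n t"
  obtains T where "labeled_tree n T" "x \<in> tree_simplex e n t T"
proof -
  have x1: "x $ e 1 \<le> 1 + t" and xi: "\<And>i. i \<in> {2..n} \<Longrightarrow> x $ e i \<le> (1 + t) * x $ e (i - 1)"
    using x by (auto simp: cayley_polytope_def)
  have ge: "1 \<le> x $ e i" if "i \<in> {1..n}" for i
  proof (cases "i = 1")
    case True
    then show ?thesis using x by (simp add: cayley_polytope_def)
  next
    case False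
    with that have "i \<in> {2..n}" by auto
    then show ?thesis using x by (simp add: cayley_polytope_def)
  qed
  define j where "j i = (LEAST j. x $ e i \<le> (1 + t) ^ Suc j)" for i
  have "\<exists>j. x $ e i \<le> (1 + t) ^ Suc j" for i
  proof -
    obtain j where "x $ e i < (1 + t) ^ j" using real_arch_pow[of "1 + t"] t by auto
    also have "\<dots> \<le> (1 + t) ^ Suc j" using t by (intro power_increasing) simp_all
    finally show ?thesis by (intro exI[of _ j]) simp
  qed
  then have up: "x $ e i \<le> (1 + t) ^ Suc (j i)" for i
    unfolding j_def by (rule LeastI_ex)
  have j_le: "j i \<le> k" if "x $ e i \<le> (1 + t) ^ Suc k" for i k
    unfolding j_def using that by (rule Least_le)
  have low: "(1 + t) ^ j i \<le> x $ e i" if i: "i \<in> {1..n}" for i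
  proof (cases "j i")
    case 0
    then show ?thesis using ge[OF i] by simp
  next
    case (Suc k)
    then have "\<not> x $ e i \<le> (1 + t) ^ Suc k" using j_le[of i k] by auto
    then show ?thesis using Suc by simp
  qed
  define y where "y i = x $ e i / (1 + t) ^ j i" for i
  have d: "(0 :: real) < (1 + t) ^ k" for k using t by simp
  have y: "1 \<le> y i" "y i \<le> 1 + t" if "i \<in> {1..n}" for i
    using low[OF that] up[of i] d[of "j i"] by (simp_all add: y_def field_simps)
  have step: "j (Suc i) \<le> j i \<or> j (Suc i) = Suc (j i) \<and> y (Suc i) \<le> y i"
    if i: "1 \<le> i" "Suc i \<le> n" for i
  proof -
    have le: "x $ e (Suc i) \<le> (1 + t) * x $ e i" using xi[of "Suc i"] i by simp
    also have "\<dots> \<le> (1 + t) * (1 + t) ^ Suc (j i)" using up[of i] t by (intro mult_left_mono) simp_all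
    finally have "x $ e (Suc i) \<le> (1 + t) ^ Suc (Suc (j i))" by simp
    then have "j (Suc i) \<le> Suc (j i)" by (rule j_le)
    moreover have "y (Suc i) \<le> y i" if "j (Suc i) = Suc (j i)"
    proof -
      have "x $ e (Suc i) / (1 + t) \<le> x $ e i" using le t by (simp add: pos_divide_le_eq mult.commute)
      then have "x $ e (Suc i) / (1 + t) / (1 + t) ^ j i \<le> x $ e i / (1 + t) ^ j i"
        using d[of "j i"] by (intro divide_right_mono) simp_all
      then show ?thesis by (simp add: y_def that)
    qed
    ultimately show ?thesis by (auto simp: le_Suc_eq)
  qed
  obtain lab where lab: "bij_betw lab {1..n} {1..n}"
    "\<And>i j. i \<in> {1..n} \<Longrightarrow> j \<in> {1..n} \<Longrightarrow> y i < y j \<or> y i = y j \<and> j < i \<Longrightarrow> lab i < lab j"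
    using ranking_exists[of n y] by blast
  define P where "P = inv_into {1..n} lab"
  have bP: "bij_betw P {1..n} {1..n}" unfolding P_def by (rule bij_betw_inv_into[OF lab(1)])
  have P: "P k \<in> {1..n}" "lab (P k) = k" if "k \<in> {1..n}" for k
    using bij_betwE[OF bP] bij_betw_inv_into_right[OF lab(1) that] that by (simp_all add: P_def)
  have first: "j (P k) = 0" if "P k = 1" for k
    using j_le[of 1 0] x1 unfolding that by simp
  have code: "j (P k') \<le> j (P k) \<or> j (P k') = Suc (j (P k)) \<and> k' < k"
    if k: "k \<in> {1..n}" "k' \<in> {1..n}" "P k' = Suc (P k)" for k k'
  proof -
    have "1 \<le> P k" "Suc (P k) \<le> n" using P(1)[OF k(1)] P(1)[OF k(2)] k(3) by simp_all
    from step[OF this] show ?thesis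
    proof
      assume *: "j (Suc (P k)) = Suc (j (P k)) \<and> y (Suc (P k)) \<le> y (P k)"
      then have "y (P k') < y (P k) \<or> y (P k') = y (P k) \<and> P k < P k'" unfolding k(3) by auto
      then have "lab (P k') < lab (P k)" by (rule lab(2)[OF P(1)[OF k(2)] P(1)[OF k(1)]])
      then show ?thesis using * P(2)[OF k(1)] P(2)[OF k(2)] k(3) by simp
    qed (simp add: k(3))
  qed
  obtain T where T: "labeled_tree n T" "\<forall>k\<in>{1..n}. nfs_position n T k = P k"
    "\<forall>k\<in>{1..n}. canes_from n T k = j (P k)"
  proof (rule labeled_tree_of_code[OF bP, of "\<lambda>k. j (P k)"])
    show "j (P k) = 0" if "P k = 1" for k using first[OF that] .
    show "j (P k') \<le> j (P k) \<or> j (P k') = Suc (j (P k)) \<and> k' < k"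
      if "k \<in> {1..n}" "k' \<in> {1..n}" "P k' = Suc (P k)" for k k'
      using code[OF that] .
    fix U assume U: "labeled_tree n U" "\<And>k. k \<in> {1..n} \<Longrightarrow> nfs_position n U k = P k"
      "\<And>k. k \<in> {1..n} \<Longrightarrow> canes_from n U k = j (P k)"
    show thesis by (rule that[OF U(1)]) (simp_all add: U(2,3))
  qed
  have "chain n t (\<lambda>k. y (P k))"
    unfolding chain_def
  proof (intro conjI ballI)
    show "1 \<le> y (P 1)" "y (P n) \<le> 1 + t" using y P(1) n by simp_all
    fix k assume "k \<in> {1..<n}"
    then have k: "k \<in> {1..n}" "k + 1 \<in> {1..n}" by auto
    show "y (P k) \<le> y (P (k + 1))"
    proof (rule ccontr)
      assume "\<not> y (P k) \<le> y (P (k + 1))"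
      then have "lab (P (k + 1)) < lab (P k)"
        by (intro lab(2)[OF P(1)[OF k(2)] P(1)[OF k(1)]]) simp
      then show False using P(2)[OF k(1)] P(2)[OF k(2)] by simp
    qed
  qed
  then have "x \<in> tree_simplex e n t T"
    using chain_cong[OF n, of "\<lambda>k. y (P k)"
        "\<lambda>k. x $ (e \<circ> nfs_position n T) k / (1 + t) ^ canes_from n T k" t] T(2,3)
    by (simp add: tree_simplex_chain chain_simplex_def y_def)
  with T(1) that show thesis by blast
qed

lemma polyhedron_cayley_polytope:
  fixes e :: "nat \<Rightarrow> 'n::finite"
  assumes "n \<ge> 1"
  shows "polyhedron (cayley_polytope e n t)"
proof -
  have ge: "polyhedron {x :: real ^ 'n. 1 \<le> x $ i}" for i
    using polyhedron_halfspace_ge[where a = "axis i 1 :: real ^ 'n" and b = 1] by (simp add: inner_axis')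
  have le: "polyhedron {x :: real ^ 'n. x $ i \<le> b}" for i b
    using polyhedron_halfspace_le[of "axis i 1 :: real ^ 'n" b] by (simp add: inner_axis')
  have diff: "polyhedron {x :: real ^ 'n. x $ i \<le> (1 + t) * x $ k}" for i k
    using polyhedron_halfspace_le[of "axis i 1 - (1 + t) *\<^sub>R axis k 1 :: real ^ 'n" 0]
    by (simp add: inner_axis' inner_diff_left)
  have "cayley_polytope e n t = {x. 1 \<le> x $ e 1} \<inter> {x. x $ e 1 \<le> 1 + t} \<inter>
      \<Inter> ((\<lambda>i. {x. 1 \<le> x $ e i} \<inter> {x. x $ e i \<le> (1 + t) * x $ e (i - 1)}) ` {2..n})"
    unfolding cayley_polytope_def by auto
  moreover have "polyhedron (\<Inter> ((\<lambda>i. {x :: real ^ 'n. 1 \<le> x $ e i} \<inter>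
      {x. x $ e i \<le> (1 + t) * x $ e (i - 1)}) ` {2..n}))"
  proof (rule polyhedron_Inter)
    fix S assume "S \<in> (\<lambda>i. {x :: real ^ 'n. 1 \<le> x $ e i} \<inter> {x. x $ e i \<le> (1 + t) * x $ e (i - 1)}) ` {2..n}"
    then obtain i where "S = {x. 1 \<le> x $ e i} \<inter> {x. x $ e i \<le> (1 + t) * x $ e (i - 1)}" by blast
    then show "polyhedron S" by (simp only: polyhedron_Int ge diff)
  qed simp
  ultimately show ?thesis by (simp only: polyhedron_Int ge le)
qed

lemma finite_labeled_trees: "finite {T. labeled_tree n T}"
proof (rule finite_subset)
  show "{T. labeled_tree n T} \<subseteq> Pow (Pow {1..n+1})"
    by (auto simp: labeled_tree_def connected_graph_def labeled_graph_def)
qed simp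

lemma finite_connected_graphs: "finite {G. connected_graph n G}"
proof (rule finite_subset)
  show "{G. connected_graph n G} \<subseteq> Pow (Pow {1..n+1})"
    by (auto simp: connected_graph_def labeled_graph_def)
qed simp

text \<open>Injectivity is claimed separately because a triangulation is a set of simplices, which
  would not reveal two trees with the same simplex.\<close>

theorem theorem6p1:
  fixes n :: nat and t :: real and e :: "nat \<Rightarrow> 'n::finite"
  assumes "n \<ge> 1" and "t > 0"
    and "bij_betw e {1..n} (UNIV :: 'n set)"
  shows
    "(\<forall>T. labeled_tree n T \<longrightarrow>
        int n simplex tree_simplex e n t T \<and>
        fact n * measure lebesgue (tree_simplex e n t T) =
          (\<Sum>G | connected_graph n G \<and> nfs_forest n G = T. t ^ card G) \<and>
        (\<Sum>G | connected_graph n G \<and> nfs_forest n G = T. t ^ card G) =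
          t ^ n * (1 + t) ^ cane_number n T) \<and>
     inj_on (tree_simplex e n t) {T. labeled_tree n T} \<and>
     polytope_triangulation (tree_simplex e n t ` {T. labeled_tree n T}) (cayley_polytope e n t) \<and>
     fact n * measure lebesgue (cayley_polytope e n t) =
       (\<Sum>G | connected_graph n G. t ^ card G)"
proof (intro conjI allI impI)
  let ?S = "tree_simplex e n t" and ?trees = "{T. labeled_tree n T}"
  let ?fiber = "\<lambda>T. {G. connected_graph n G \<and> nfs_forest n G = T}"
  have simplex: "int n simplex ?S T" if "labeled_tree n T" for T
    using simplex_tree_simplex assms that by blast
  have volume: "fact n * measure lebesgue (?S T) = (\<Sum>G\<in>?fiber T. t ^ card G)"
    if "labeled_tree n T" for T
    unfolding sum_connected_nfs_tree[OF that] using measure_tree_simplex assms that by blast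
  show "int n simplex ?S T" "fact n * measure lebesgue (?S T) = (\<Sum>G\<in>?fiber T. t ^ card G)"
    "(\<Sum>G\<in>?fiber T. t ^ card G) = t ^ n * (1 + t) ^ cane_number n T"
    if "labeled_tree n T" for T
    using simplex volume sum_connected_nfs_tree that by blast+
  have disjoint: "interior (?S T) \<inter> interior (?S T') = {}"
    if "labeled_tree n T" "labeled_tree n T'" "T \<noteq> T'" for T T'
    using interior_tree_simplex_disjoint assms that by blast
  have overlap: "negligible (?S T \<inter> ?S T')"
    if "labeled_tree n T" "labeled_tree n T'" "T \<noteq> T'" for T T'
    using negligible_simplex_Int[OF simplex[OF that(1)] simplex[OF that(2)] disjoint[OF that]] .
  show "inj_on ?S ?trees"
  proof (rule inj_onI, rule ccontr)
    fix T T' assume T: "T \<in> ?trees" and T': "T' \<in> ?trees" and eq: "?S T = ?S T'" and "T \<noteq> T'"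
    \<comment> \<open>Equal simplices of different trees would overlap negligibly and so have volume
      0, against the volume formula.\<close>
    then have "negligible (?S T)" using overlap[of T T'] by simp
    then have "fact n * measure lebesgue (?S T) = 0" by (simp add: negligible_imp_measure0)
    moreover have "fact n * measure lebesgue (?S T) > 0"
      using measure_tree_simplex[OF assms] T assms(2) by simp
    ultimately show False by simp
  qed
  have union: "\<Union> (?S ` ?trees) = cayley_polytope e n t"
  proof
    show "\<Union> (?S ` ?trees) \<subseteq> cayley_polytope e n t"
      using tree_simplex_subset[OF assms(1,2)] by blast
    show "cayley_polytope e n t \<subseteq> \<Union> (?S ` ?trees)"
      using cayley_polytope_covered[OF assms(1,2)] by blast
  qed
  have compact: "compact (?S T)" if "T \<in> ?trees" for T
    using compact_simplex simplex that by blast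
  have "polytope (cayley_polytope e n t)"
  proof -
    \<comment> \<open>Boundedness of the polytope comes from its covering by finitely many compact
      simplices, without estimates on coordinates.\<close>
    have "compact (\<Union> (?S ` ?trees))"
      by (intro compact_UN finite_labeled_trees compact)
    then show ?thesis
      unfolding polytope_eq_bounded_polyhedron union
      using polyhedron_cayley_polytope[OF assms(1)] compact_imp_bounded by blast
  qed
  moreover have "int DIM(real ^ 'n) = int n" using bij_betw_same_card[OF assms(3)] by simp
  moreover have "pairwise (\<lambda>S S'. interior S \<inter> interior S' = {}) (?S ` ?trees)"
    unfolding pairwise_def using disjoint by blast
  ultimately show "polytope_triangulation (?S ` ?trees) (cayley_polytope e n t)"
    unfolding polytope_triangulation_def using union simplex by simp
  have "measure lebesgue (cayley_polytope e n t) = (\<Sum>T\<in>?trees. measure lebesgue (?S T))"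
    unfolding union[symmetric]
  proof (rule measure_negligible_finite_Union_image[OF finite_labeled_trees])
    show "?S T \<in> lmeasurable" if "T \<in> ?trees" for T
      using compact[OF that] by (rule lmeasurable_compact)
    show "pairwise (\<lambda>T T'. negligible (?S T \<inter> ?S T')) ?trees"
      using overlap by (simp add: pairwise_def)
  qed
  then have "fact n * measure lebesgue (cayley_polytope e n t) =
      (\<Sum>T\<in>?trees. \<Sum>G\<in>?fiber T. t ^ card G)"
    using volume by (simp add: sum_distrib_left)
  also have "\<dots> = (\<Sum>T\<in>?trees. \<Sum>G | G \<in> {G. connected_graph n G} \<and> nfs_forest n G = T. t ^ card G)"
    by simp
  \<comment> \<open>The fibers of \<open>nfs_forest\<close> over the labeled trees partition the
    connected graphs.\<close>
  also have "\<dots> = (\<Sum>G | connected_graph n G. t ^ card G)"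
    by (rule sum.group[OF finite_connected_graphs finite_labeled_trees])
      (use nfs_forest_tree in blast)
  finally show "fact n * measure lebesgue (cayley_polytope e n t) =
      (\<Sum>G | connected_graph n G. t ^ card G)" .
qed

end
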